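(* Let $d\ge 2$ be an integer, let $\nu>0$, and let $\{Y_t(\mathbf{s}) : \mathbf{s}\in\mathbb{R}^d,\ t\in\mathbb{Z}\}$ be a zero-mean, second-order spatially and temporally stationary process with finite variance and spatio-temporal spectral density $f_Y(\underline{\lambda},\omega)$, $\underline{\lambda}=(\lambda_1,\dots,\lambda_d)\in\mathbb{R}^d$, $\omega\in[-\pi,\pi]$. Let $J_{\mathbf{s}}(\omega)$ be the discrete Fourier transform of the data $\{Y_t(\mathbf{s}) : t=1,\dots,n\}$ at location $\mathbf{s}=(s_1,\dots,s_d)$, and let $J_{\mathbf{s},e}(\omega)$ be the discrete Fourier transform of a space-time white noise $e_t(\mathbf{s})$ with variance parameter $\sigma_e^2$. Suppose that $J_{\mathbf{s}}(\omega)$ satisfies $$\left[\sum_{i=1}^d\frac{\partial^2}{\partial s_i^2}-|c(\omega)|^2\right]^{\nu}J_{\mathbf{s}}(\omega)=J_{\mathbf{s},e}(\omega)$$ (in the spectral sense specified in the context). Then the second-order spectral density is $$f_Y(\underline{\lambda},\omega)=\frac{\sigma_e^2}{(2\pi)^d}\,\frac{1}{\left(\sum_{i=1}^d\lambda_i^2+|c(\omega)|^2\right)^{2\nu}}.$$ If moreover the process is isotropic, then the covariance function $g_{\|\mathbf{h}\|}(\omega)=\mathrm{Cov}(J_{\mathbf{s}}(\omega),J_{\mathbf{s}+\mathbf{h}}(\omega))$ (understood asymptotically, as specified in the context) is, for $\mathbf{h}\in\mathbb{R}^d$, $\mathbf{h}\neq\mathbf{0}$, $$g_{\|\mathbf{h}\|}(\omega)=\frac{\sigma_e^2}{(2\pi)^{d/2}\,2^{2\nu-1}\,\Gamma(2\nu)}\left(\frac{\|\mathbf{h}\|}{|c(\omega)|}\right)^{2\nu-\frac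 d2}K_{2\nu-\frac d2}\left(\|\mathbf{h}\|\,|c(\omega)|\right),$$ where $\|\mathbf{h}\|$ is the Euclidean norm and $K_\mu$ is the modified Bessel function of the second kind of order $\mu$. (Identities are for almost every $(\underline{\lambda},\omega)$, respectively almost every $\omega$.)
   Context: Spectral representation: $Y_t(\mathbf{s})=\int_{\mathbb{R}^d}\int_{-\pi}^{\pi}e^{i(\mathbf{s}\cdot\underline{\lambda}+t\omega)}\,dZ_Y(\underline{\lambda},\omega)$, where $Z_Y$ is a zero-mean complex process with orthogonal increments and $E|dZ_Y(\underline{\lambda},\omega)|^2=f_Y(\underline{\lambda},\omega)\,d\underline{\lambda}\,d\omega$. The covariance function is $c(\mathbf{h},u)=\mathrm{Cov}[Y_t(\mathbf{s}),Y_{t+u}(\mathbf{s}+\mathbf{h})]=\int_{\mathbb{R}^d}\int_{-\pi}^{\pi}e^{i(\mathbf{h}\cdot\underline{\lambda}+u\omega)}f_Y(\underline{\lambda},\omega)\,d\omega\,d\underline{\lambda}$. Finite variance means $f_Y$ is integrable on $\mathbb{R}^d\times[-\pi,\pi]$. The process is isotropic if $c(\mathbf{h},u)$ depends on $\mathbf{h}$ only through the Euclidean norm $\|\mathbf{h}\|$. Discrete Fourier transform: $J_{\mathbf{s}}(\omega)=\frac{1}{\sqrt{2\pi n}}\sum_{t=1}^nY_t(\mathbf{s})e^{-it\omega}$, and $J_{\mathbf{s},e}(\omega)$ is defined in the same way from $e_t(\mathbf{s})$. Throughout, $J_{\mathbf{s}}(\omega)$ and $J_{\mathbf{s},e}(\omega)$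 are identified with their large-$n$ spectral representations $J_{\mathbf{s}}(\omega)=\int_{\mathbb{R}^d}e^{i\mathbf{s}\cdot\underline{\lambda}}\sqrt{n/2\pi}\,dZ_Y(\underline{\lambda},\omega)$ and $J_{\mathbf{s},e}(\omega)=\int_{\mathbb{R}^d}e^{i\mathbf{s}\cdot\underline{\lambda}}\sqrt{n/2\pi}\,dZ_e(\underline{\lambda},\omega)$ (integration over the wave number $\underline{\lambda}$ only), where $Z_e$ is the zero-mean orthogonal-increment process of the white noise, with constant spectral density normalized by $E|dZ_e(\underline{\lambda},\omega)|^2=\frac{\sigma_e^2}{(2\pi)^d}\,d\underline{\lambda}\,d\omega$. Meaning of the equation: the operator $\left[\sum_{j}\partial^2/\partial s_j^2-|c(\omega)|^2\right]^{\nu}$ acts under the integral as the Fourier multiplier $e^{i\mathbf{s}\cdot\underline{\lambda}}\mapsto\left(-\|\underline{\lambda}\|^2-|c(\omega)|^2\right)^{\nu}e^{i\mathbf{s}\cdot\underline{\lambda}}$ (a fixed branch of the power), and the equation is an equality of the resulting spectral increments. Here $c(\omega)$ is a (measurable) function of the temporal frequency with $|c(\omega)|>0$; it is unrelated to the covariance function $c(\mathbf{h},u)$. Covariance of the transforms: $\mathrm{Cov}(J_{\mathbf{s}}(\omega),J_{\mathbf{s}+\mathbf{h}}(\omega))$ is understood as its large-$n$ value, the cross spectrum $g_{\|\mathbf{h}\|}(\omega)$, i.e. the function of $\omega$ whose Fourier coefficients are the covariances $c(\mathbf{h},u)$, formally $\frac1{2\pi}\sum_{u}c(\|\mathbf{h}\|,u)e^{-iu\omega}$;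 equivalently $g_{\|\mathbf{h}\|}(\omega)=\int_{\mathbb{R}^d}e^{i\mathbf{h}\cdot\underline{\lambda}}f_Y(\underline{\lambda},\omega)\,d\underline{\lambda}$. *)

theory Defs
  imports "HOL-Probability.Probability"
begin

definition freq_domain :: "real measure" where
  "freq_domain = restrict_space lborel {-pi..pi}"

definition spectral_domain :: "((real ^ 'd) \<times> real) measure" where
  "spectral_domain = lborel \<Otimes>\<^sub>M freq_domain"

definition spectral_measure ::
  "((real ^ 'd) \<times> real \<Rightarrow> real) \<Rightarrow> ((real ^ 'd) \<times> real) measure" where
  "spectral_measure f = density spectral_domain (\<lambda>p. ennreal (f p))"

definition white_noise_spectrum :: "real \<Rightarrow> ((real ^ 'd) \<times> real) measure" where
  "white_noise_spectrum \<sigma> = spectral_measure (\<lambda>_. \<sigma>\<^sup>2 / (2 * pi) ^ CARD('d))"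


text \<open>The conjugate is on the first argument, so that with
  \<open>c(h,u) = Cov[Y t s, Y (t+u) (s+h)]\<close> the kernel of the spectral representation of \<open>c\<close>
  is \<open>exp (\<i> (h \<bullet> l + u w))\<close>, also for complex-valued processes.\<close>

definition covariance :: "'w measure \<Rightarrow> ('w \<Rightarrow> complex) \<Rightarrow> ('w \<Rightarrow> complex) \<Rightarrow> complex" where
  "covariance M X W =
     (\<integral>x. cnj (X x - (\<integral>y. X y \<partial>M)) * (W x - (\<integral>y. W y \<partial>M)) \<partial>M)"

definition finite_variance :: "'w measure \<Rightarrow> ('w \<Rightarrow> complex) \<Rightarrow> bool" where
  "finite_variance M X \<longleftrightarrow> X \<in> borel_measurable M \<and> integrable M (\<lambda>x. (cmod (X x))\<^sup>2)"

definition second_order_stationary ::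
  "'w measure \<Rightarrow> (int \<Rightarrow> real ^ 'd \<Rightarrow> 'w \<Rightarrow> complex) \<Rightarrow> bool" where
  "second_order_stationary M Y \<longleftrightarrow>
     (\<forall>t s. finite_variance M (Y t s)) \<and>
     (\<forall>t s t' s'. (\<integral>x. Y t s x \<partial>M) = (\<integral>x. Y t' s' x \<partial>M)) \<and>
     (\<forall>t s t' s' u h. covariance M (Y t s) (Y (t + u) (s + h)) =
                       covariance M (Y t' s') (Y (t' + u) (s' + h)))"

definition cov_fun ::
  "'w measure \<Rightarrow> (int \<Rightarrow> real ^ 'd \<Rightarrow> 'w \<Rightarrow> complex) \<Rightarrow> real ^ 'd \<Rightarrow> int \<Rightarrow> complex" where
  "cov_fun M Y h u = covariance M (Y 0 0) (Y u h)"

definition isotropic ::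
  "'w measure \<Rightarrow> (int \<Rightarrow> real ^ 'd \<Rightarrow> 'w \<Rightarrow> complex) \<Rightarrow> bool" where
  "isotropic M Y \<longleftrightarrow> (\<forall>h h' u. norm h = norm h' \<longrightarrow> cov_fun M Y h u = cov_fun M Y h' u)"


text \<open>\<open>Z\<close> is indexed by the sets of finite \<open>F\<close>-measure, where \<open>F\<close> is the control measure:
  \<open>E |dZ|\<^sup>2 = dF\<close>.  Its values on other sets are irrelevant.\<close>

definition orthogonal_increments ::
  "'w measure \<Rightarrow> 'p measure \<Rightarrow> ('p set \<Rightarrow> 'w \<Rightarrow> complex) \<Rightarrow> bool" where
  "orthogonal_increments M F Z \<longleftrightarrow>
     (\<forall>A\<in>sets F. emeasure F A < \<infinity> \<longrightarrow>
        finite_variance M (Z A) \<and>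
        (\<integral>x. Z A x \<partial>M) = 0 \<and>
        (\<integral>x. (cmod (Z A x))\<^sup>2 \<partial>M) = measure F A) \<and>
     (\<forall>A\<in>sets F. \<forall>B\<in>sets F. emeasure F A < \<infinity> \<longrightarrow> emeasure F B < \<infinity> \<longrightarrow> A \<inter> B = {} \<longrightarrow>
        (AE x in M. Z (A \<union> B) x = Z A x + Z B x) \<and>
        (\<integral>x. Z A x * cnj (Z B x) \<partial>M) = 0)"

definition simple_stoch_integral ::
  "'p measure \<Rightarrow> ('p set \<Rightarrow> 'w \<Rightarrow> complex) \<Rightarrow> ('p \<Rightarrow> complex) \<Rightarrow> 'w \<Rightarrow> complex" where
  "simple_stoch_integral F Z \<phi> x = (\<Sum>y\<in>\<phi> ` space F. y * Z {p \<in> space F. \<phi> p = y} x)"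

text \<open>\<open>has_stoch_integral M F Z f X\<close>: the random variable \<open>X\<close> is a version of \<open>\<integral> f dZ\<close>,
  the mean-square limit of the integrals of simple functions converging to \<open>f\<close> in \<open>L\<^sup>2(F)\<close>.\<close>

definition has_stoch_integral ::
  "'w measure \<Rightarrow> 'p measure \<Rightarrow> ('p set \<Rightarrow> 'w \<Rightarrow> complex) \<Rightarrow> ('p \<Rightarrow> complex) \<Rightarrow> ('w \<Rightarrow> complex) \<Rightarrow> bool"
  where
  "has_stoch_integral M F Z f X \<longleftrightarrow>
     f \<in> borel_measurable F \<and> X \<in> borel_measurable M \<and>
     (\<exists>\<phi>::nat \<Rightarrow> 'p \<Rightarrow> complex.
        (\<forall>k. Bochner_Integration.simple_bochner_integrable F (\<phi> k)) \<and>
        (\<lambda>k. \<integral>\<^sup>+p. ennreal ((cmod (\<phi> k p - f p))\<^sup>2) \<partial>F) \<longlonglongrightarrow> 0 \<and>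
        (\<lambda>k. \<integral>\<^sup>+x. ennreal ((cmod (simple_stoch_integral F Z (\<phi> k) x - X x))\<^sup>2) \<partial>M) \<longlonglongrightarrow> 0)"

definition spectral_representation ::
  "'w measure \<Rightarrow> ((real ^ 'd) \<times> real) measure \<Rightarrow> (((real ^ 'd) \<times> real) set \<Rightarrow> 'w \<Rightarrow> complex) \<Rightarrow>
   (int \<Rightarrow> real ^ 'd \<Rightarrow> 'w \<Rightarrow> complex) \<Rightarrow> bool" where
  "spectral_representation M F Z Y \<longleftrightarrow>
     (\<forall>t s. has_stoch_integral M F Z
        (\<lambda>(l, w). exp (\<i> * complex_of_real (s \<bullet> l + real_of_int t * w))) (Y t s))"


text \<open>The large-\<open>n\<close> form \<open>\<integral> exp (\<i> s \<bullet> l) sqrt (n / 2\<pi>) dZ(l, w)\<close> of the discrete Fourier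
  transform at \<open>s\<close> is integrated in the wave number only, hence is itself an increment in the
  frequency; for white noise the integral over all wave numbers diverges.  The transform is
  therefore represented by its spectral increments, \<open>X\<close> being the one over the set \<open>A\<close>.
  A multiplier \<open>m\<close> acts under the integral; \<open>m = 1\<close> gives the transform itself.\<close>

definition dft_increment ::
  "'w measure \<Rightarrow> ((real ^ 'd) \<times> real) measure \<Rightarrow> (((real ^ 'd) \<times> real) set \<Rightarrow> 'w \<Rightarrow> complex) \<Rightarrow>
   nat \<Rightarrow> ((real ^ 'd) \<times> real \<Rightarrow> complex) \<Rightarrow> real ^ 'd \<Rightarrow> ((real ^ 'd) \<times> real) set \<Rightarrow>
   ('w \<Rightarrow> complex) \<Rightarrow> bool" where
  "dft_increment M F Z n m s A X \<longleftrightarrow>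
     has_stoch_integral M F Z
       (\<lambda>(l, w). indicator A (l, w) * m (l, w) * exp (\<i> * complex_of_real (s \<bullet> l)) *
                 complex_of_real (sqrt (real n / (2 * pi)))) X"

text \<open>The symbol \<open>(- |l|\<^sup>2 - |c w|\<^sup>2)\<^sup>\<nu>\<close> of the operator; the base is a negative real number, and
  \<open>k\<close> selects the branch of its logarithm (\<open>k = 0\<close> is the principal one).\<close>

definition operator_symbol ::
  "int \<Rightarrow> (real \<Rightarrow> complex) \<Rightarrow> real \<Rightarrow> (real ^ 'd) \<times> real \<Rightarrow> complex" where
  "operator_symbol k c \<nu> = (\<lambda>(l, w).
     exp (complex_of_real \<nu> *
       (Ln (complex_of_real (- (\<Sum>i\<in>UNIV. (l $ i)\<^sup>2) - (cmod (c w))\<^sup>2)) +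
        2 * complex_of_real pi * \<i> * of_int k)))"

text \<open>\<open>[\<Sum>\<^sub>i \<partial>\<^sup>2/\<partial>s\<^sub>i\<^sup>2 - |c w|\<^sup>2]\<^sup>\<nu> J\<^sub>s = J\<^sub>s\<^sub>,\<^sub>e\<close> as an equality (almost surely, as
  \<open>dft_increment\<close> determines \<open>X\<close> up to null sets) of spectral increments.\<close>

definition satisfies_fractional_spde ::
  "'w measure \<Rightarrow>
   ((real ^ 'd) \<times> real) measure \<Rightarrow> (((real ^ 'd) \<times> real) set \<Rightarrow> 'w \<Rightarrow> complex) \<Rightarrow>
   ((real ^ 'd) \<times> real) measure \<Rightarrow> (((real ^ 'd) \<times> real) set \<Rightarrow> 'w \<Rightarrow> complex) \<Rightarrow>
   nat \<Rightarrow> int \<Rightarrow> (real \<Rightarrow> complex) \<Rightarrow> real \<Rightarrow> bool" where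
  "satisfies_fractional_spde M FY ZY Fe Ze n k c \<nu> \<longleftrightarrow>
     (\<forall>s. \<forall>A\<in>sets spectral_domain. bounded A \<longrightarrow>
        (\<exists>X. dft_increment M FY ZY n (operator_symbol k c \<nu>) s A X \<and>
             dft_increment M Fe Ze n (\<lambda>_. 1) s A X))"


text \<open>The asymptotic covariance of the transforms at locations differing by \<open>h\<close>, as a function
  of the frequency: its Fourier coefficients are the covariances \<open>c(h, u)\<close>, formally
  \<open>g w = (1 / 2\<pi>) \<Sum>\<^sub>u c(h, u) exp (- \<i> u w)\<close>.\<close>

definition is_cross_spectrum ::
  "'w measure \<Rightarrow> (int \<Rightarrow> real ^ 'd \<Rightarrow> 'w \<Rightarrow> complex) \<Rightarrow> real ^ 'd \<Rightarrow> (real \<Rightarrow> complex) \<Rightarrow> bool" where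
  "is_cross_spectrum M Y h g \<longleftrightarrow>
     integrable freq_domain g \<and>
     (\<forall>u::int. (\<integral>w. exp (\<i> * complex_of_real (real_of_int u * w)) * g w \<partial>freq_domain)
               = cov_fun M Y h u)"


text \<open>Modified Bessel function of the second kind, by the integral representation valid
  for all real orders and all \<open>x > 0\<close>.\<close>

definition bessel_K :: "real \<Rightarrow> real \<Rightarrow> real" where
  "bessel_K \<mu> x = (LBINT t:{0..}. exp (- x * cosh t) * cosh (\<mu> * t))"

end

theory Submission
  imports Defs
begin

text \<open>
  The stochastic integral is an isometry from \<open>L\<^sup>2\<close> of the control measure to \<open>L\<^sup>2(M)\<close>.  At
  \<open>s = 0\<close>, taking second moments of the two representations of one spectral increment over a bounded
  set \<open>A\<close> gives \<open>\<integral>\<^sub>A f\<^sub>Y (|l|\<^sup>2 + |c|\<^sup>2)\<^sup>2\<^sup>\<nu> = \<sigma>\<^sub>e\<^sup>2 (2\<pi>)\<^sup>-\<^sup>d \<integral>\<^sub>A 1\<close> up to the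
  common factor \<open>n / 2\<pi>\<close>: the modulus of the symbol does not depend on the branch of the power.  As
  \<open>A\<close> is arbitrary, this determines \<open>f\<^sub>Y\<close>.

  By the isometry and Fubini's theorem, the wave number integral \<open>\<integral> exp (\<i> h \<bullet> l) f\<^sub>Y(l, w) dl\<close> has
  the Fourier coefficients \<open>c(h, u)\<close>, and an integrable function on \<open>[-\<pi>, \<pi>]\<close> is determined almost
  everywhere by its Fourier coefficients.  The integral is evaluated by writing the power
  \<open>r\<^sup>-\<^sup>a\<close> as a mixture of the exponentials \<open>exp (- r e\<^sup>s)\<close>, which turns it into a mixture of
  Gaussian Fourier transforms; a shift of \<open>s\<close> makes the exponent a multiple of \<open>cosh s\<close>.
\<close>

section \<open>The isometry of the stochastic integral\<close>

lemma borel_measurable_cnj [measurable (raw)]: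
  assumes "f \<in> borel_measurable M"
  shows "(\<lambda>x. cnj (f x)) \<in> borel_measurable M"
  by (rule measurable_compose[OF assms borel_measurable_continuous_onI]) (intro continuous_intros)

lemma finite_variance_diff:
  assumes "finite_variance M X" "finite_variance M W"
  shows "finite_variance M (\<lambda>x. X x - W x)"
proof -
  have m[measurable]: "X \<in> borel_measurable M" "W \<in> borel_measurable M"
    using assms by (auto simp: finite_variance_def)
  have "integrable M (\<lambda>x. (cmod (X x - W x))\<^sup>2)"
  proof (rule Bochner_Integration.integrable_bound)
    show "integrable M (\<lambda>x. 2 * (cmod (X x))\<^sup>2 + 2 * (cmod (W x))\<^sup>2)"
      using assms by (auto simp: finite_variance_def)
    show "AE x in M. norm ((cmod (X x - W x))\<^sup>2) \<le> norm (2 * (cmod (X x))\<^sup>2 + 2 * (cmod (W x))\<^sup>2)"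
    proof (rule AE_I2)
      fix x
      have "(cmod (X x - W x))\<^sup>2 \<le> (cmod (X x) + cmod (W x))\<^sup>2"
        by (intro power_mono norm_triangle_ineq4) simp
      also have "\<dots> \<le> 2 * (cmod (X x))\<^sup>2 + 2 * (cmod (W x))\<^sup>2"
        using sum_squares_bound[of "cmod (X x)" "cmod (W x)"] by (simp add: power2_sum)
      finally show "norm ((cmod (X x - W x))\<^sup>2) \<le> norm (2 * (cmod (X x))\<^sup>2 + 2 * (cmod (W x))\<^sup>2)"
        by simp
    qed
  qed simp
  then show ?thesis by (simp add: finite_variance_def)
qed

lemma finite_variance_uminus: "finite_variance M X \<Longrightarrow> finite_variance M (\<lambda>x. - X x)"
  by (simp add: finite_variance_def)

lemma finite_variance_cmult: "finite_variance M X \<Longrightarrow> finite_variance M (\<lambda>x. z * X x)"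
  by (auto simp: finite_variance_def norm_mult power_mult_distrib)

lemma finite_variance_zero: "finite_variance M (\<lambda>x. 0)"
  by (simp add: finite_variance_def)

lemma finite_variance_add:
  assumes "finite_variance M X" "finite_variance M W"
  shows "finite_variance M (\<lambda>x. X x + W x)"
  using finite_variance_diff[OF assms(1) finite_variance_uminus[OF assms(2)]] by simp

lemma finite_variance_sum:
  "(\<And>i. i \<in> I \<Longrightarrow> finite_variance M (X i)) \<Longrightarrow> finite_variance M (\<lambda>x. \<Sum>i\<in>I. X i x)"
  by (induction I rule: infinite_finite_induct) (auto intro: finite_variance_add finite_variance_zero)

lemma integrable_norm_mult_finite_variance:
  assumes "finite_variance M X" "finite_variance M W"
  shows "integrable M (\<lambda>x. cmod (X x) * cmod (W x))"
proof -
  have m[measurable]: "X \<in> borel_measurable M" "W \<in> borel_measurable M"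
    using assms by (auto simp: finite_variance_def)
  show ?thesis
  proof (rule Bochner_Integration.integrable_bound)
    show "integrable M (\<lambda>x. (cmod (X x))\<^sup>2 + (cmod (W x))\<^sup>2)"
      using assms by (auto simp: finite_variance_def)
    show "AE x in M. norm (cmod (X x) * cmod (W x)) \<le> norm ((cmod (X x))\<^sup>2 + (cmod (W x))\<^sup>2)"
    proof (rule AE_I2)
      fix x
      have "2 * (cmod (X x) * cmod (W x)) \<le> (cmod (X x))\<^sup>2 + (cmod (W x))\<^sup>2"
        using sum_squares_bound[of "cmod (X x)" "cmod (W x)"] by simp
      moreover have nonneg: "0 \<le> cmod (X x) * cmod (W x)" by simp
      ultimately have "cmod (X x) * cmod (W x) \<le> (cmod (X x))\<^sup>2 + (cmod (W x))\<^sup>2" by linarith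
      then show "norm (cmod (X x) * cmod (W x)) \<le> norm ((cmod (X x))\<^sup>2 + (cmod (W x))\<^sup>2)"
        using nonneg by simp
    qed
  qed simp
qed

lemma integrable_cnj_mult_finite_variance:
  assumes "finite_variance M X" "finite_variance M W"
  shows "integrable M (\<lambda>x. cnj (X x) * W x)"
proof -
  have m[measurable]: "X \<in> borel_measurable M" "W \<in> borel_measurable M"
    using assms by (auto simp: finite_variance_def)
  show ?thesis
    using integrable_norm_mult_finite_variance[OF assms]
    by (rule Bochner_Integration.integrable_bound) (auto simp: norm_mult)
qed

lemma nn_integral_norm_square:
  assumes "finite_variance M X"
  shows "(\<integral>\<^sup>+x. ennreal ((cmod (X x))\<^sup>2) \<partial>M) = ennreal (\<integral>x. (cmod (X x))\<^sup>2 \<partial>M)"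
  using assms by (intro nn_integral_eq_integral) (auto simp: finite_variance_def)

text \<open>Cauchy-Schwarz is applied to the moduli as extended nonnegative integrals; finiteness of
  both second moments carries it back to the reals.\<close>

lemma norm_inner_le_finite_variance:
  assumes X: "finite_variance M X" and W: "finite_variance M W"
  shows "cmod (\<integral>x. cnj (X x) * W x \<partial>M)
    \<le> sqrt (\<integral>x. (cmod (X x))\<^sup>2 \<partial>M) * sqrt (\<integral>x. (cmod (W x))\<^sup>2 \<partial>M)"
proof -
  have m[measurable]: "X \<in> borel_measurable M" "W \<in> borel_measurable M"
    using assms by (auto simp: finite_variance_def)
  let ?I = "\<integral>x. cmod (X x) * cmod (W x) \<partial>M"
  have "ennreal (?I\<^sup>2) = (\<integral>\<^sup>+x. ennreal (cmod (X x)) * ennreal (cmod (W x)) \<partial>M)\<^sup>2"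
    using nn_integral_eq_integral[OF integrable_norm_mult_finite_variance[OF assms]]
    by (simp add: ennreal_mult' ennreal_power)
  also have "\<dots> \<le> (\<integral>\<^sup>+x. (ennreal (cmod (X x)))\<^sup>2 \<partial>M) * (\<integral>\<^sup>+x. (ennreal (cmod (W x)))\<^sup>2 \<partial>M)"
    by (rule Cauchy_Schwarz_nn_integral) auto
  also have "\<dots> = ennreal ((\<integral>x. (cmod (X x))\<^sup>2 \<partial>M) * (\<integral>x. (cmod (W x))\<^sup>2 \<partial>M))"
    using nn_integral_norm_square[OF X] nn_integral_norm_square[OF W]
    by (simp add: ennreal_power ennreal_mult')
  finally have "?I\<^sup>2 \<le> (\<integral>x. (cmod (X x))\<^sup>2 \<partial>M) * (\<integral>x. (cmod (W x))\<^sup>2 \<partial>M)"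
    by (subst (asm) ennreal_le_iff) auto
  then have le: "?I \<le> sqrt ((\<integral>x. (cmod (X x))\<^sup>2 \<partial>M) * (\<integral>x. (cmod (W x))\<^sup>2 \<partial>M))"
    by (rule real_le_rsqrt)
  have "cmod (\<integral>x. cnj (X x) * W x \<partial>M) \<le> (\<integral>x. cmod (cnj (X x) * W x) \<partial>M)"
    by (rule integral_norm_bound)
  with le show ?thesis by (simp add: norm_mult real_sqrt_mult)
qed

text \<open>The limits in \<open>has_stoch_integral\<close> use extended nonnegative integrals,
  which make sense before anything is known about the second moment of the limit. A single
  \<open>X k\<close> at squared distance below 1 already gives \<open>Y\<close> a finite second
  moment, because \<open>Y\<close> is \<open>X k\<close> minus the difference; afterwards the
  convergence can be read in the real norm.\<close>

lemma finite_variance_L2_limit: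
  assumes "\<And>k. finite_variance M (X k)" and [measurable]: "Y \<in> borel_measurable M"
    and "(\<lambda>k. \<integral>\<^sup>+x. ennreal ((cmod (X k x - Y x))\<^sup>2) \<partial>M) \<longlonglongrightarrow> 0"
  shows "finite_variance M Y"
    and "(\<lambda>k. sqrt (\<integral>x. (cmod (X k x - Y x))\<^sup>2 \<partial>M)) \<longlonglongrightarrow> 0"
proof -
  have m[measurable]: "X k \<in> borel_measurable M" for k
    using assms by (auto simp: finite_variance_def)
  have "eventually (\<lambda>k. (\<integral>\<^sup>+x. ennreal ((cmod (X k x - Y x))\<^sup>2) \<partial>M) < 1) sequentially"
    using assms(3) by (rule order_tendstoD) simp
  then obtain k where k: "(\<integral>\<^sup>+x. ennreal ((cmod (X k x - Y x))\<^sup>2) \<partial>M) < 1"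
    by (auto simp: eventually_sequentially)
  have "finite_variance M (\<lambda>x. X k x - Y x)"
    unfolding finite_variance_def
    using order.strict_trans[OF k, of top] by (auto intro!: integrableI_bounded)
  from finite_variance_diff[OF assms(1)[of k] this] show Y: "finite_variance M Y" by simp
  have fv: "finite_variance M (\<lambda>x. X k x - Y x)" for k
    by (intro finite_variance_diff assms(1) Y)
  have "(\<lambda>k. ennreal (\<integral>x. (cmod (X k x - Y x))\<^sup>2 \<partial>M)) \<longlonglongrightarrow> ennreal 0"
    using assms(3) by (simp add: nn_integral_norm_square[OF fv])
  then have "(\<lambda>k. (\<integral>x. (cmod (X k x - Y x))\<^sup>2 \<partial>M)) \<longlonglongrightarrow> 0"
    by (subst (asm) tendsto_ennreal_iff) auto
  from tendsto_real_sqrt[OF this] show "(\<lambda>k. sqrt (\<integral>x. (cmod (X k x - Y x))\<^sup>2 \<partial>M)) \<longlonglongrightarrow> 0"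
    by simp
qed

text \<open>Continuity of the inner product. Expanding around \<open>X'\<close> and
  \<open>W'\<close> and subtracting the limit leaves three terms, each with a factor whose norm
  tends to 0, and Cauchy-Schwarz bounds each of them.\<close>

lemma tendsto_inner_L2:
  assumes X: "\<And>k. finite_variance M (X k)" and X': "finite_variance M X'"
    and W: "\<And>k. finite_variance M (W k)" and W': "finite_variance M W'"
    and limX: "(\<lambda>k. sqrt (\<integral>x. (cmod (X k x - X' x))\<^sup>2 \<partial>M)) \<longlonglongrightarrow> 0"
    and limW: "(\<lambda>k. sqrt (\<integral>x. (cmod (W k x - W' x))\<^sup>2 \<partial>M)) \<longlonglongrightarrow> 0"
  shows "(\<lambda>k. \<integral>x. cnj (X k x) * W k x \<partial>M) \<longlonglongrightarrow> (\<integral>x. cnj (X' x) * W' x \<partial>M)"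
proof -
  let ?D = "\<lambda>k x. X k x - X' x" and ?E = "\<lambda>k x. W k x - W' x"
  note D = finite_variance_diff[OF X X'] and E = finite_variance_diff[OF W W']
  let ?n = "\<lambda>V. sqrt (\<integral>x. (cmod (V x))\<^sup>2 \<partial>M)"
  let ?b = "\<lambda>k. ?n (?D k) * ?n (?E k) + ?n X' * ?n (?E k) + ?n (?D k) * ?n W'"
  have "(\<lambda>k. (\<integral>x. cnj (X k x) * W k x \<partial>M) - (\<integral>x. cnj (X' x) * W' x \<partial>M)) \<longlonglongrightarrow> 0"
  proof (rule Lim_null_comparison)
    show "\<forall>\<^sub>F k in sequentially. norm ((\<integral>x. cnj (X k x) * W k x \<partial>M) - (\<integral>x. cnj (X' x) * W' x \<partial>M)) \<le> ?b k"
    proof (rule always_eventually, rule allI)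
      fix k
      have "(\<integral>x. cnj (X k x) * W k x \<partial>M) =
        (\<integral>x. cnj (?D k x) * ?E k x + cnj (X' x) * ?E k x + cnj (?D k x) * W' x + cnj (X' x) * W' x \<partial>M)"
        by (rule Bochner_Integration.integral_cong) (auto simp: algebra_simps)
      also have "\<dots> = (\<integral>x. cnj (?D k x) * ?E k x \<partial>M) + (\<integral>x. cnj (X' x) * ?E k x \<partial>M)
          + (\<integral>x. cnj (?D k x) * W' x \<partial>M) + (\<integral>x. cnj (X' x) * W' x \<partial>M)"
        by (intro has_bochner_integral_integral_eq has_bochner_integral_add has_bochner_integral_integrable
            integrable_cnj_mult_finite_variance D E X' W')
      finally have eq: "(\<integral>x. cnj (X k x) * W k x \<partial>M) - (\<integral>x. cnj (X' x) * W' x \<partial>M) =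
        (\<integral>x. cnj (?D k x) * ?E k x \<partial>M) + (\<integral>x. cnj (X' x) * ?E k x \<partial>M) + (\<integral>x. cnj (?D k x) * W' x \<partial>M)"
        by (simp only: add_diff_cancel_right')
      show "norm ((\<integral>x. cnj (X k x) * W k x \<partial>M) - (\<integral>x. cnj (X' x) * W' x \<partial>M)) \<le> ?b k"
        unfolding eq
        by (intro norm_triangle_le add_mono norm_inner_le_finite_variance D E X' W')
    qed
    have "?b \<longlonglongrightarrow> 0 * 0 + ?n X' * 0 + 0 * ?n W'"
      by (intro tendsto_intros limX limW)
    then show "?b \<longlonglongrightarrow> 0" by simp
  qed
  then show ?thesis by (rule LIM_zero_cancel)
qed

text \<open>The common part and the two differences of \<open>A\<close> and \<open>B\<close> are
  pairwise disjoint. Additivity of \<open>Z\<close> over these pieces and orthogonality leave only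
  the second moment of the increment over the common part.\<close>

lemma orthogonal_increments_inner:
  assumes Z: "orthogonal_increments M F Z"
    and A: "A \<in> sets F" "emeasure F A < \<infinity>" and B: "B \<in> sets F" "emeasure F B < \<infinity>"
  shows "(\<integral>x. cnj (Z A x) * Z B x \<partial>M) = complex_of_real (measure F (A \<inter> B))"
proof -
  let ?S = "{A \<in> sets F. emeasure F A < \<infinity>}"
  let ?C = "A \<inter> B" and ?P = "A - B" and ?Q = "B - A"
  have fin: "C \<in> ?S \<Longrightarrow> D \<subseteq> C \<Longrightarrow> D \<in> sets F \<Longrightarrow> D \<in> ?S" for C D
    using emeasure_mono[of D C F] by (auto intro: le_less_trans)
  have "?C \<in> ?S" by (rule fin[of A]) (use A B in auto)
  moreover have "?P \<in> ?S" by (rule fin[of A]) (use A B in auto)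
  moreover have "?Q \<in> ?S" by (rule fin[of B]) (use A B in auto)
  ultimately have S: "?C \<in> ?S" "?P \<in> ?S" "?Q \<in> ?S" .
  have fv: "finite_variance M (Z D)" if "D \<in> ?S" for D
    using Z that by (auto simp: orthogonal_increments_def)
  have orth: "(\<integral>x. cnj (Z D x) * Z E x \<partial>M) = 0" if "D \<in> ?S" "E \<in> ?S" "D \<inter> E = {}" for D E
  proof -
    have "(\<integral>x. Z E x * cnj (Z D x) \<partial>M) = 0"
      using Z that by (auto simp: orthogonal_increments_def Int_commute)
    then show ?thesis by (simp add: mult.commute)
  qed
  have add: "AE x in M. Z (D \<union> E) x = Z D x + Z E x" if "D \<in> ?S" "E \<in> ?S" "D \<inter> E = {}" for D E
    using Z that by (auto simp: orthogonal_increments_def)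
  have d: "?C \<inter> ?Q = {}" "?P \<inter> ?C = {}" "?P \<inter> ?Q = {}" by auto
  have AE1: "AE x in M. Z A x = Z ?C x + Z ?P x"
    using add[OF S(1,2)] by (simp add: Int_Diff_Un Int_Diff_disjoint)
  have AE2: "AE x in M. Z B x = Z ?C x + Z ?Q x"
  proof -
    have "?C \<union> ?Q = B" "?C \<inter> ?Q = {}" by auto
    then show ?thesis using add[OF S(1,3)] by simp
  qed
  note [measurable] = fv[OF S(1), unfolded finite_variance_def, THEN conjunct1]
    fv[OF S(2), unfolded finite_variance_def, THEN conjunct1]
    fv[OF S(3), unfolded finite_variance_def, THEN conjunct1]
  have [measurable]: "Z A \<in> borel_measurable M" "Z B \<in> borel_measurable M"
    using fv[of A] fv[of B] A B by (auto simp: finite_variance_def)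
  \<comment> \<open>Additivity of \<open>Z\<close> holds only almost surely, so the integrands are
    compared almost everywhere.\<close>
  have "(\<integral>x. cnj (Z A x) * Z B x \<partial>M) = (\<integral>x. cnj (Z ?C x) * Z ?C x + cnj (Z ?C x) * Z ?Q x
      + cnj (Z ?P x) * Z ?C x + cnj (Z ?P x) * Z ?Q x \<partial>M)"
    by (rule integral_cong_AE) (use AE1 AE2 in \<open>auto simp: algebra_simps\<close>)
  also have "\<dots> = (\<integral>x. cnj (Z ?C x) * Z ?C x \<partial>M) + (\<integral>x. cnj (Z ?C x) * Z ?Q x \<partial>M)
      + (\<integral>x. cnj (Z ?P x) * Z ?C x \<partial>M) + (\<integral>x. cnj (Z ?P x) * Z ?Q x \<partial>M)"
    by (intro has_bochner_integral_integral_eq has_bochner_integral_add has_bochner_integral_integrable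
            integrable_cnj_mult_finite_variance fv S)
  also have "\<dots> = (\<integral>x. cnj (Z ?C x) * Z ?C x \<partial>M)"
    using orth[OF S(1,3) d(1)] orth[OF S(2,1) d(2)] orth[OF S(2,3) d(3)] by simp
  also have "\<dots> = (\<integral>x. complex_of_real ((cmod (Z ?C x))\<^sup>2) \<partial>M)"
    by (rule Bochner_Integration.integral_cong) (auto simp: complex_norm_square mult.commute simp del: of_real_power)
  also have "\<dots> = complex_of_real (measure F ?C)"
    using Z S(1) by (auto simp: orthogonal_increments_def simp del: of_real_power)
  finally show ?thesis .
qed

section \<open>Stochastic integrals of simple functions\<close>

lemma simple_function_level_sum:
  fixes g :: "'a \<Rightarrow> complex"
  assumes "finite S" "g p \<in> S"
  shows "(\<Sum>y\<in>S - {0}. y * complex_of_real (indicator {q \<in> \<Omega>. g q = y} p)) = (if p \<in> \<Omega> then g p else 0)"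
proof -
  have "(\<Sum>y\<in>S - {0}. y * complex_of_real (indicator {q \<in> \<Omega>. g q = y} p)) =
     (\<Sum>y\<in>S - {0}. if g p = y then (if p \<in> \<Omega> then g p else 0) else 0)"
    by (rule sum.cong) (auto simp: indicator_def)
  also have "\<dots> = (if p \<in> \<Omega> then g p else 0)"
    using assms by (subst sum.delta') auto
  finally show ?thesis .
qed

text \<open>The level set of the value 0 may have infinite control measure, where nothing is known
  about \<open>Z\<close>. Its term carries the factor 0 and is removed here once and for
  all.\<close>

lemma simple_stoch_integral_eq:
  assumes "simple_function F \<phi>"
  shows "simple_stoch_integral F Z \<phi> x =
    (\<Sum>y\<in>\<phi> ` space F - {0}. y * Z {p \<in> space F. \<phi> p = y} x)"
  unfolding simple_stoch_integral_def
  by (rule sum.mono_neutral_right) (use assms in \<open>auto simp: simple_function_def\<close>)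

lemma level_set_finite_measure:
  assumes "Bochner_Integration.simple_bochner_integrable F \<phi>" "y \<noteq> 0"
  shows "{p \<in> space F. \<phi> p = y} \<in> sets F" "emeasure F {p \<in> space F. \<phi> p = y} < \<infinity>"
proof -
  have sf: "simple_function F \<phi>" and fin: "emeasure F {p \<in> space F. \<phi> p \<noteq> 0} \<noteq> \<infinity>"
    using assms(1) by (auto elim: simple_bochner_integrable.cases)
  have [measurable]: "\<phi> \<in> measurable F (count_space UNIV)"
    by (rule measurable_simple_function[OF sf])
  show "{p \<in> space F. \<phi> p = y} \<in> sets F" by measurable
  have "emeasure F {p \<in> space F. \<phi> p = y} \<le> emeasure F {p \<in> space F. \<phi> p \<noteq> 0}"
    by (rule emeasure_mono) (use assms(2) in auto)
  then show "emeasure F {p \<in> space F. \<phi> p = y} < \<infinity>"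
    using fin by (simp add: le_less_trans less_top)
qed

lemma simple_stoch_integral_finite_variance:
  assumes "orthogonal_increments M F Z" "Bochner_Integration.simple_bochner_integrable F \<phi>"
  shows "finite_variance M (simple_stoch_integral F Z \<phi>)"
proof -
  have sf: "simple_function F \<phi>" using assms(2) by (auto elim: simple_bochner_integrable.cases)
  have "finite_variance M (\<lambda>x. \<Sum>y\<in>\<phi> ` space F - {0}. y * Z {p \<in> space F. \<phi> p = y} x)"
    using assms level_set_finite_measure[OF assms(2)]
    by (intro finite_variance_sum finite_variance_cmult) (auto simp: orthogonal_increments_def)
  moreover have "simple_stoch_integral F Z \<phi> = (\<lambda>x. \<Sum>y\<in>\<phi> ` space F - {0}. y * Z {p \<in> space F. \<phi> p = y} x)"
    by (intro ext simple_stoch_integral_eq sf)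
  ultimately show ?thesis by simp
qed

lemma simple_bochner_integrable_finite_variance:
  assumes "Bochner_Integration.simple_bochner_integrable F \<phi>"
  shows "finite_variance F \<phi>"
proof -
  have sf: "simple_function F \<phi>" using assms by (auto elim: simple_bochner_integrable.cases)
  have "Bochner_Integration.simple_bochner_integrable F (\<lambda>x. (cmod (\<phi> x))\<^sup>2)"
    by (rule simple_bochner_integrable_compose2[OF _ assms assms, of "\<lambda>a b. (cmod a)\<^sup>2"]) simp
  then have "integrable F (\<lambda>x. (cmod (\<phi> x))\<^sup>2)"
    using integrable.simps has_bochner_integral_simple_bochner_integrable by blast
  then show ?thesis
    using borel_measurable_simple_function[OF sf] by (simp add: finite_variance_def)
qed

text \<open>Both sides are the same double sum over pairs of nonzero values: a pair contributes the
  measure of the intersection of two level sets, on the left as the inner product of two increments,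
  on the right as the integral of an indicator.\<close>

lemma simple_stoch_integral_inner:
  assumes Z: "orthogonal_increments M F Z"
    and \<phi>: "Bochner_Integration.simple_bochner_integrable F \<phi>"
    and \<psi>: "Bochner_Integration.simple_bochner_integrable F \<psi>"
  shows "(\<integral>x. cnj (simple_stoch_integral F Z \<phi> x) * simple_stoch_integral F Z \<psi> x \<partial>M) =
    (\<integral>p. cnj (\<phi> p) * \<psi> p \<partial>F)"
proof -
  have sf: "simple_function F \<phi>" "simple_function F \<psi>"
    using \<phi> \<psi> by (auto elim: simple_bochner_integrable.cases)
  have fin: "finite (\<phi> ` space F)" "finite (\<psi> ` space F)"
    using sf by (auto simp: simple_function_def)
  let ?A = "\<lambda>y. {p \<in> space F. \<phi> p = y}" and ?B = "\<lambda>y. {p \<in> space F. \<psi> p = y}"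
  let ?S = "\<phi> ` space F - {0}" and ?T = "\<psi> ` space F - {0}"
  note A = level_set_finite_measure[OF \<phi>] and B = level_set_finite_measure[OF \<psi>]
  have fv: "finite_variance M (Z (?A y))" "finite_variance M (Z (?B y))" if "y \<noteq> 0" for y
    using Z A[OF that] B[OF that] by (auto simp: orthogonal_increments_def)
  have "(\<integral>x. cnj (simple_stoch_integral F Z \<phi> x) * simple_stoch_integral F Z \<psi> x \<partial>M) =
     (\<integral>x. (\<Sum>y\<in>?S. \<Sum>z\<in>?T. cnj y * z * (cnj (Z (?A y) x) * Z (?B z) x)) \<partial>M)"
    unfolding simple_stoch_integral_eq[OF sf(1)] simple_stoch_integral_eq[OF sf(2)] cnj_sum sum_product
    by (intro Bochner_Integration.integral_cong sum.cong refl) (simp add: mult_ac)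
  also have "\<dots> = (\<Sum>y\<in>?S. \<Sum>z\<in>?T. cnj y * z * (\<integral>x. cnj (Z (?A y) x) * Z (?B z) x \<partial>M))"
    by (intro has_bochner_integral_integral_eq has_bochner_integral_sum has_bochner_integral_mult_right
         has_bochner_integral_integrable integrable_cnj_mult_finite_variance fv) auto
  also have "\<dots> = (\<Sum>y\<in>?S. \<Sum>z\<in>?T. cnj y * z * complex_of_real (measure F (?A y \<inter> ?B z)))"
    by (intro sum.cong refl arg_cong2[where f="(*)"] orthogonal_increments_inner[OF Z] A B) auto
  also have "\<dots> = (\<integral>p. (\<Sum>y\<in>?S. \<Sum>z\<in>?T. cnj y * z * complex_of_real (indicator (?A y \<inter> ?B z) p)) \<partial>F)"
  proof (intro has_bochner_integral_integral_eq[symmetric] has_bochner_integral_sum has_bochner_integral_mult_right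
         has_bochner_integral_of_real has_bochner_integral_real_indicator)
    fix y z assume yz: "y \<in> ?S" "z \<in> ?T"
    have "emeasure F (?A y \<inter> ?B z) \<le> emeasure F (?A y)"
      using A[of y] yz by (intro emeasure_mono) auto
    then show "emeasure F (?A y \<inter> ?B z) < \<infinity>"
      using A(2)[of y] yz by (auto intro: le_less_trans)
    show "?A y \<inter> ?B z \<in> sets F"
      using A(1)[of y] B(1)[of z] yz by blast
  qed
  also have "\<dots> = (\<integral>p. cnj (\<phi> p) * \<psi> p \<partial>F)"
  proof (rule Bochner_Integration.integral_cong[OF refl])
    fix p assume p: "p \<in> space F"
    have "(\<Sum>y\<in>?S. \<Sum>z\<in>?T. cnj y * z * complex_of_real (indicator (?A y \<inter> ?B z) p)) =
      cnj (\<Sum>y\<in>?S. y * complex_of_real (indicator (?A y) p)) *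
      (\<Sum>z\<in>?T. z * complex_of_real (indicator (?B z) p))"
      unfolding cnj_sum sum_product indicator_inter_arith
      by (intro sum.cong refl) (simp add: mult_ac)
    also have "\<dots> = cnj (\<phi> p) * \<psi> p"
      using p by (simp add: simple_function_level_sum fin)
    finally show "(\<Sum>y\<in>?S. \<Sum>z\<in>?T. cnj y * z * complex_of_real (indicator (?A y \<inter> ?B z) p)) = cnj (\<phi> p) * \<psi> p" .
  qed
  finally show ?thesis .
qed

text \<open>The two inner products agree on simple approximants and are continuous under the
  mean-square limits that define the integral, so their limits agree. The form with two integrands
  is the one needed for covariances.\<close>

theorem stoch_integral_isometry:
  assumes Z: "orthogonal_increments M F Z"
    and X: "has_stoch_integral M F Z f X" and W: "has_stoch_integral M F Z g W"
  shows "finite_variance M X" "finite_variance F f"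
    and "(\<integral>x. cnj (X x) * W x \<partial>M) = (\<integral>p. cnj (f p) * g p \<partial>F)"
proof -
  \<comment> \<open>The definition of the integral is turned into convergence of real norms for an
    arbitrary integrand, to be applied to \<open>f\<close> and to \<open>g\<close> with separate
    approximating sequences.\<close>
  have lim: "\<exists>\<phi>. (\<forall>k. finite_variance M (simple_stoch_integral F Z (\<phi> k)) \<and> finite_variance F (\<phi> k) \<and>
      Bochner_Integration.simple_bochner_integrable F (\<phi> k)) \<and>
      finite_variance M X \<and> finite_variance F f \<and> (\<lambda>k. sqrt (\<integral>p. (cmod (\<phi> k p - f p))\<^sup>2 \<partial>F)) \<longlonglongrightarrow> 0 \<and>
      (\<lambda>k. sqrt (\<integral>x. (cmod (simple_stoch_integral F Z (\<phi> k) x - X x))\<^sup>2 \<partial>M)) \<longlonglongrightarrow> 0"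
    if "has_stoch_integral M F Z f X" for f X
  proof -
    from that obtain \<phi> where [measurable]: "f \<in> borel_measurable F" "X \<in> borel_measurable M"
      and \<phi>: "\<And>k. Bochner_Integration.simple_bochner_integrable F (\<phi> k)"
      and l1: "(\<lambda>k. \<integral>\<^sup>+p. ennreal ((cmod (\<phi> k p - f p))\<^sup>2) \<partial>F) \<longlonglongrightarrow> 0"
      and l2: "(\<lambda>k. \<integral>\<^sup>+x. ennreal ((cmod (simple_stoch_integral F Z (\<phi> k) x - X x))\<^sup>2) \<partial>M) \<longlonglongrightarrow> 0"
      by (auto simp: has_stoch_integral_def)
    note fv = simple_stoch_integral_finite_variance[OF Z \<phi>] simple_bochner_integrable_finite_variance[OF \<phi>]
    show ?thesis
      using finite_variance_L2_limit[OF fv(2) _ l1] finite_variance_L2_limit[OF fv(1) _ l2] fv \<phi>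
      by (intro exI[of _ \<phi>]) auto
  qed
  obtain \<phi> where \<phi>: "\<And>k. finite_variance M (simple_stoch_integral F Z (\<phi> k))" "\<And>k. finite_variance F (\<phi> k)"
      "\<And>k. Bochner_Integration.simple_bochner_integrable F (\<phi> k)"
      "finite_variance M X" "finite_variance F f" "(\<lambda>k. sqrt (\<integral>p. (cmod (\<phi> k p - f p))\<^sup>2 \<partial>F)) \<longlonglongrightarrow> 0"
      "(\<lambda>k. sqrt (\<integral>x. (cmod (simple_stoch_integral F Z (\<phi> k) x - X x))\<^sup>2 \<partial>M)) \<longlonglongrightarrow> 0"
    using lim[OF X] by blast
  obtain \<psi> where \<psi>: "\<And>k. finite_variance M (simple_stoch_integral F Z (\<psi> k))" "\<And>k. finite_variance F (\<psi> k)"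
      "\<And>k. Bochner_Integration.simple_bochner_integrable F (\<psi> k)"
      "finite_variance M W" "finite_variance F g" "(\<lambda>k. sqrt (\<integral>p. (cmod (\<psi> k p - g p))\<^sup>2 \<partial>F)) \<longlonglongrightarrow> 0"
      "(\<lambda>k. sqrt (\<integral>x. (cmod (simple_stoch_integral F Z (\<psi> k) x - W x))\<^sup>2 \<partial>M)) \<longlonglongrightarrow> 0"
    using lim[OF W] by blast
  show "finite_variance M X" "finite_variance F f" by fact+
  note tendsto_inner_L2[OF \<phi>(1,4) \<psi>(1,4) \<phi>(7) \<psi>(7)]
  moreover note tendsto_inner_L2[OF \<phi>(2,5) \<psi>(2,5) \<phi>(6) \<psi>(6)]
  ultimately show "(\<integral>x. cnj (X x) * W x \<partial>M) = (\<integral>p. cnj (f p) * g p \<partial>F)"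
    unfolding simple_stoch_integral_inner[OF Z \<phi>(3) \<psi>(3)] by (rule LIMSEQ_unique)
qed

text \<open>With extended nonnegative integrals, a control measure given by a density can afterwards
  be unfolded without integrability conditions.\<close>

lemma stoch_integral_norm:
  assumes Z: "orthogonal_increments M F Z" and X: "has_stoch_integral M F Z f X"
  shows "(\<integral>\<^sup>+x. ennreal ((cmod (X x))\<^sup>2) \<partial>M) = (\<integral>\<^sup>+p. ennreal ((cmod (f p))\<^sup>2) \<partial>F)"
proof -
  note iso = stoch_integral_isometry[OF Z X X]
  have "complex_of_real (\<integral>x. (cmod (X x))\<^sup>2 \<partial>M) = complex_of_real (\<integral>p. (cmod (f p))\<^sup>2 \<partial>F)"
    using iso(3)
    by (simp only: complex_norm_square mult.commute[of "cnj _"] flip: integral_complex_of_real)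
  then show ?thesis
    using nn_integral_norm_square[OF iso(1)] nn_integral_norm_square[OF iso(2)]
    by (simp only: of_real_eq_iff)
qed

section \<open>Uniqueness of Fourier coefficients\<close>

lemma space_freq_domain [simp]: "space freq_domain = {-pi..pi}"
  by (simp add: freq_domain_def space_restrict_space)

lemma sets_freq_domain: "sets freq_domain = sets (restrict_space borel {-pi..pi})"
  by (simp add: freq_domain_def sets_restrict_space)

lemma finite_measure_freq_domain: "finite_measure freq_domain"
  by (rule finite_measureI) (simp add: freq_domain_def emeasure_restrict_space space_restrict_space)

lemma borel_measurable_freq_domain [measurable (raw)]:
  "f \<in> borel_measurable borel \<Longrightarrow> f \<in> borel_measurable freq_domain"
  unfolding freq_domain_def by (rule measurable_restrict_space1) simp

text \<open>Integrability is demanded explicitly: for a function that is not integrable all the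
  integrals would be 0 merely by the default value of the Bochner integral.\<close>

definition fourier_annihilated :: "(real \<Rightarrow> complex) \<Rightarrow> bool" where
  "fourier_annihilated g \<longleftrightarrow> integrable freq_domain g \<and>
    (\<forall>u::int. (\<integral>w. cis (of_int u * w) * g w \<partial>freq_domain) = 0)"

lemma cis_measurable [measurable (raw)]:
  "f \<in> borel_measurable M \<Longrightarrow> (\<lambda>x. cis (f x)) \<in> borel_measurable M"
  by (rule measurable_compose[OF _ borel_measurable_continuous_onI]) (auto intro!: continuous_intros)

lemma integrable_bounded_mult:
  fixes g :: "'a \<Rightarrow> complex"
  assumes "integrable M g" "\<phi> \<in> borel_measurable M" "\<And>x. x \<in> space M \<Longrightarrow> cmod (\<phi> x) \<le> K"
  shows "integrable M (\<lambda>x. \<phi> x * g x)"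
proof (rule Bochner_Integration.integrable_bound)
  show "integrable M (\<lambda>x. K * cmod (g x))" using assms(1) by simp
  show "(\<lambda>x. \<phi> x * g x) \<in> borel_measurable M" using assms by measurable
  show "AE x in M. norm (\<phi> x * g x) \<le> norm (K * cmod (g x))"
  proof (rule AE_I2)
    fix x assume "x \<in> space M"
    then have "cmod (\<phi> x) * cmod (g x) \<le> K * cmod (g x)" by (intro mult_right_mono assms) auto
    also have "\<dots> \<le> \<bar>K * cmod (g x)\<bar>" by simp
    finally show "norm (\<phi> x * g x) \<le> norm (K * cmod (g x))" by (simp add: norm_mult)
  qed
qed

lemma fourier_annihilated_add:
  assumes "fourier_annihilated f" "fourier_annihilated g"
  shows "fourier_annihilated (\<lambda>w. f w + g w)"
proof -
  have int: "integrable freq_domain (\<lambda>w. cis (of_int u * w) * f w)" "integrable freq_domain (\<lambda>w. cis (of_int u * w) * g w)" for u :: int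
    using assms by (auto intro!: integrable_bounded_mult[where K=1] simp: fourier_annihilated_def)
  show ?thesis
    using assms by (simp add: fourier_annihilated_def distrib_left int)
qed

text \<open>A character only shifts the index of the coefficients. Together with closure under sums,
  this makes the annihilated functions a module over the trigonometric polynomials.\<close>

lemma fourier_annihilated_cis:
  assumes "fourier_annihilated g"
  shows "fourier_annihilated (\<lambda>w. z * (cis (of_int k * w) * g w))"
  unfolding fourier_annihilated_def
proof (intro conjI allI)
  have "integrable freq_domain (\<lambda>w. cis (of_int k * w) * g w)"
    using assms by (auto intro!: integrable_bounded_mult[where K=1] simp: fourier_annihilated_def)
  then show "integrable freq_domain (\<lambda>w. z * (cis (of_int k * w) * g w))" by simp
  fix u :: int
  have "(\<integral>w. cis (of_int u * w) * (z * (cis (of_int k * w) * g w)) \<partial>freq_domain) =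
    (\<integral>w. z * (cis (of_int (u + k) * w) * g w) \<partial>freq_domain)"
    by (rule Bochner_Integration.integral_cong) (simp_all add: distrib_right flip: cis_mult)
  also have "\<dots> = z * (\<integral>w. cis (of_int (u + k) * w) * g w \<partial>freq_domain)" by simp
  also have "\<dots> = 0" using assms by (simp add: fourier_annihilated_def del: of_int_add)
  finally show "(\<integral>w. cis (of_int u * w) * (z * (cis (of_int k * w) * g w)) \<partial>freq_domain) = 0" .
qed

text \<open>Annihilation of the product, and not only the vanishing of its integral, makes the
  multiplicative step of the induction immediate.\<close>

lemma fourier_annihilated_real_polynomial:
  assumes "real_polynomial_function p" "fourier_annihilated g"
  shows "fourier_annihilated (\<lambda>w. of_real (p (cis w)) * g w)"
  using assms
proof (induction arbitrary: g)
  case (linear f)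
  interpret bounded_linear f by fact
  have f: "f (cis w) = cos w * f 1 + sin w * f \<i>" for w
  proof -
    have "cis w = cos w *\<^sub>R 1 + sin w *\<^sub>R \<i>" by (simp add: complex_eq_iff)
    then show ?thesis by (simp only: add scaleR) simp
  qed
  \<comment> \<open>By Euler's formulas for cos and sin, \<open>?a\<close> and \<open>?b\<close> are
    the Fourier coefficients of index 1 and -1 of the linear functional restricted to the unit
    circle.\<close>
  let ?a = "(of_real (f 1) - \<i> * of_real (f \<i>)) / 2" and ?b = "(of_real (f 1) + \<i> * of_real (f \<i>)) / 2"
  have "of_real (f (cis w)) * g w = ?a * (cis (of_int 1 * w) * g w) + ?b * (cis (of_int (-1) * w) * g w)" for w
    unfolding f by (simp add: complex_eq_iff field_simps)
  then show ?case
    by (simp only:) (intro fourier_annihilated_add fourier_annihilated_cis linear.prems)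
next
  case (const c)
  show ?case using fourier_annihilated_cis[OF const, of "of_real c" 0] by simp
next
  case (add f h)
  then show ?case by (simp add: distrib_right fourier_annihilated_add)
next
  case (mult f h)
  then show ?case by (simp add: mult.assoc)
qed

text \<open>By Stone-Weierstrass on the unit circle, \<open>f\<close> is uniformly within
  \<open>e\<close> of a real polynomial, whose integral against \<open>g\<close> vanishes. The
  integral is therefore at most \<open>e\<close> times the L1 norm of \<open>g\<close>, for every
  positive \<open>e\<close>.\<close>

lemma fourier_annihilated_continuous:
  fixes f :: "complex \<Rightarrow> real"
  assumes g: "fourier_annihilated g" and f: "continuous_on UNIV f"
  shows "(\<integral>w. of_real (f (cis w)) * g w \<partial>freq_domain) = 0"
proof -
  let ?I = "\<integral>w. of_real (f (cis w)) * g w \<partial>freq_domain"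
  have gi: "integrable freq_domain g" using g by (simp add: fourier_annihilated_def)
  have [measurable]: "f \<in> borel_measurable borel"
    using f by (rule borel_measurable_continuous_onI)
  obtain B where B: "\<And>z. z \<in> sphere 0 1 \<Longrightarrow> norm (f z) \<le> B"
    using compact_imp_bounded[OF compact_continuous_image[OF continuous_on_subset[OF f subset_UNIV] compact_sphere[of "0::complex" 1]]]
    unfolding bounded_iff by blast
  have fi: "integrable freq_domain (\<lambda>w. of_real (f (cis w)) * g w)"
    by (rule integrable_bounded_mult[OF gi, of _ B]) (use B in auto)
  have "cmod ?I \<le> e * (\<integral>w. cmod (g w) \<partial>freq_domain)" if "e > 0" for e
  proof -
    obtain p where p: "real_polynomial_function p" "\<And>z. z \<in> sphere 0 1 \<Longrightarrow> \<bar>f z - p z\<bar> < e"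
      using Stone_Weierstrass_real_polynomial_function[OF compact_sphere[of "0::complex" 1]
          continuous_on_subset[OF f subset_UNIV] \<open>e > 0\<close>]
      by blast
    have ann: "fourier_annihilated (\<lambda>w. of_real (p (cis w)) * g w)"
      by (rule fourier_annihilated_real_polynomial[OF p(1) g])
    then have pi: "integrable freq_domain (\<lambda>w. of_real (p (cis w)) * g w)"
      by (simp add: fourier_annihilated_def)
    have "(\<integral>w. of_real (p (cis w)) * g w \<partial>freq_domain) = 0"
      using ann[unfolded fourier_annihilated_def, THEN conjunct2, rule_format, of 0] by simp
    then have "?I = (\<integral>w. of_real (f (cis w)) * g w - of_real (p (cis w)) * g w \<partial>freq_domain)"
      by (simp add: fi pi)
    also have "cmod \<dots> \<le> (\<integral>w. e * cmod (g w) \<partial>freq_domain)"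
    proof (rule order.trans[OF integral_norm_bound integral_mono])
      show "integrable freq_domain (\<lambda>w. cmod (of_real (f (cis w)) * g w - of_real (p (cis w)) * g w))"
        by (intro integrable_norm Bochner_Integration.integrable_diff fi pi)
      show "integrable freq_domain (\<lambda>w. e * cmod (g w))" using gi by simp
      fix w
      have "cmod (of_real (f (cis w)) * g w - of_real (p (cis w)) * g w) = \<bar>f (cis w) - p (cis w)\<bar> * cmod (g w)"
        by (simp only: norm_mult norm_of_real flip: left_diff_distrib of_real_diff)
      also have "\<dots> \<le> e * cmod (g w)"
        by (intro mult_right_mono less_imp_le[OF p(2)]) auto
      finally show "cmod (of_real (f (cis w)) * g w - of_real (p (cis w)) * g w) \<le> e * cmod (g w)" .
    qed
    finally show ?thesis by simp
  qed
  note le = this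
  have "cmod ?I \<le> 0"
  proof (rule field_le_epsilon)
    fix e :: real assume "e > 0"
    define J where "J = (\<integral>w. cmod (g w) \<partial>freq_domain)"
    have J: "J \<ge> 0" by (simp add: J_def)
    \<comment> \<open>Dividing by \<open>J + 1\<close> instead of \<open>J\<close> avoids a separate
      case \<open>J = 0\<close>.\<close>
    have "cmod ?I \<le> e / (J + 1) * J"
      using le[of "e / (J + 1)", folded J_def] \<open>e > 0\<close> J by simp
    also have "\<dots> \<le> e" using \<open>e > 0\<close> J by (simp add: field_simps)
    finally show "cmod ?I \<le> 0 + e" by simp
  qed
  then show ?thesis by simp
qed

text \<open>\<open>Arg\<close> takes values above -pi and up to pi, so it recovers every point
  except -pi. If \<open>v\<close> were -pi, the common point on the circle would have argument pi,
  which is impossible for an interior \<open>w\<close>.\<close>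

lemma cis_inj_on_interior:
  assumes "cis v = cis w" "v \<in> {-pi..pi}" "w \<in> {-pi<..<pi}"
  shows "v = w"
proof -
  have "w = Arg (cis w)" by (rule cis_Arg_unique[symmetric]) (use assms in \<open>auto simp: sgn_eq\<close>)
  show ?thesis
  proof (cases "v = -pi")
    case True
    have "pi = Arg (cis w)"
      by (rule cis_Arg_unique[symmetric]) (use assms(1) True in \<open>auto simp: sgn_eq complex_eq_iff\<close>)
    then show ?thesis using \<open>w = Arg (cis w)\<close> assms(3) by simp
  next
    case False
    have "v = Arg (cis v)" by (rule cis_Arg_unique[symmetric]) (use assms False in \<open>auto simp: sgn_eq\<close>)
    then show ?thesis using \<open>w = Arg (cis w)\<close> assms(1) by simp
  qed
qed

section \<open>From continuous functions on the circle to closed sets and all Borel sets of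
  frequencies\<close>

lemma AE_freq_domain_interior: "AE w in freq_domain. w \<in> {-pi<..<pi}"
proof -
  have "AE w in lborel. w \<noteq> pi" "AE w in lborel. w \<noteq> -pi"
    by (rule AE_lborel_singleton)+
  then have "AE w in lborel. w \<in> {-pi..pi} \<longrightarrow> w \<in> {-pi<..<pi}"
    by eventually_elim (auto simp: less_le)
  then show ?thesis
    unfolding freq_domain_def by (subst AE_restrict_space_iff) auto
qed

text \<open>The points \<open>-\<pi>\<close> and \<open>\<pi>\<close>, which \<open>cis\<close> identifies, form a null set, so the indicator of
  \<open>K\<close> is almost everywhere that of a closed subset of the circle, a limit of continuous functions.\<close>

lemma fourier_annihilated_closed:
  assumes g: "fourier_annihilated g" and K: "closed K"
  shows "(\<integral>w. indicator K w *\<^sub>R g w \<partial>freq_domain) = 0"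
proof (cases "K \<inter> {-pi..pi} = {}")
  \<comment> \<open>The empty case is separate because \<open>infdist\<close> to the empty set is 0
    by convention, so the approximating functions of the other case would be constantly 1.\<close>
  case True
  have "(\<integral>w. indicator K w *\<^sub>R g w \<partial>freq_domain) = (\<integral>w. 0 \<partial>freq_domain)"
    by (rule Bochner_Integration.integral_cong) (use True in \<open>auto simp: indicator_def\<close>)
  then show ?thesis by simp
next
  case False
  define C where "C = cis ` (K \<inter> {-pi..pi})"
  have "compact (K \<inter> {-pi..pi})" using K by (simp add: closed_Int_compact)
  then have "compact C" unfolding C_def
    by (intro compact_continuous_image continuous_intros)
  then have C: "closed C" "C \<noteq> {}" using False by (auto simp: compact_imp_closed C_def)
  have C_iff: "cis w \<in> C \<longleftrightarrow> w \<in> K" if "w \<in> {-pi<..<pi}" for w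
    using that cis_inj_on_interior[OF _ _ that] unfolding C_def by (fastforce simp: image_iff)
  \<comment> \<open>For positive \<open>n\<close> this function is 1 on \<open>C\<close> and falls
    linearly to 0 at distance \<open>1 / n\<close>. As \<open>C\<close> is closed, the pointwise
    limit is the indicator of \<open>C\<close>.\<close>
  define f where "f n z = max 0 (1 - real n * infdist z C)" for n z
  have cont: "continuous_on UNIV (f n)" for n
    unfolding f_def by (intro continuous_intros)
  have lim: "(\<lambda>n. f n z) \<longlonglongrightarrow> indicator C z" for z
  proof (cases "z \<in> C")
    case True then show ?thesis by (simp add: f_def)
  next
    case False
    then have d: "infdist z C > 0" using C by (simp add: infdist_pos_not_in_closed)
    have "\<forall>\<^sub>F n in sequentially. f n z = 0"
      using eventually_ge_at_top[of "nat \<lceil>1 / infdist z C\<rceil>"]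
    proof eventually_elim
      case (elim n)
      then have "1 / infdist z C \<le> real n" by linarith
      then show ?case using d by (simp add: f_def field_simps)
    qed
    then show ?thesis using False by (simp add: tendsto_eventually)
  qed
  have fb: "\<bar>f n z\<bar> \<le> 1" for n z by (auto simp: f_def infdist_nonneg)
  have gi[measurable]: "integrable freq_domain g" using g by (simp add: fourier_annihilated_def)
  have [measurable]: "f n \<in> borel_measurable borel" for n
    using cont by (rule borel_measurable_continuous_onI)
  have [measurable]: "g \<in> borel_measurable freq_domain" using gi by simp
  have [measurable]: "K \<in> sets borel" using K by simp
  have "(\<lambda>n. \<integral>w. of_real (f n (cis w)) * g w \<partial>freq_domain) \<longlonglongrightarrow> (\<integral>w. indicator K w *\<^sub>R g w \<partial>freq_domain)"
  proof (rule integral_dominated_convergence[where w="\<lambda>w. cmod (g w)"])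
    show "(\<lambda>w. indicator K w *\<^sub>R g w) \<in> borel_measurable freq_domain" by measurable
    show "(\<lambda>w. of_real (f n (cis w)) * g w) \<in> borel_measurable freq_domain" for n by measurable
    show "integrable freq_domain (\<lambda>w. cmod (g w))" using gi by simp
    show "AE w in freq_domain. norm (of_real (f n (cis w)) * g w) \<le> cmod (g w)" for n
      using fb by (intro AE_I2) (simp add: norm_mult mult_left_le_one_le)
    show "AE w in freq_domain. (\<lambda>n. of_real (f n (cis w)) * g w) \<longlonglongrightarrow> indicator K w *\<^sub>R g w"
      using AE_freq_domain_interior
    proof eventually_elim
      case (elim w)
      have "(\<lambda>n. complex_of_real (f n (cis w)) * g w) \<longlonglongrightarrow> of_real (indicator C (cis w)) * g w"
        by (intro tendsto_intros lim)
      then show ?case using C_iff[OF elim] by (simp add: indicator_def scaleR_conv_of_real)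
    qed
  qed
  then show ?thesis
    by (simp add: fourier_annihilated_continuous[OF g cont] LIMSEQ_const_iff)
qed

text \<open>The Borel sets over which \<open>g\<close> integrates to 0 are closed under complements
  and countable disjoint unions, and include the closed sets, an intersection-stable generator.
  Hence they are all the Borel sets, and a function whose integral over every measurable set is 0
  vanishes almost everywhere.\<close>

lemma fourier_annihilated_AE_zero:
  assumes g: "fourier_annihilated g"
  shows "AE w in freq_domain. g w = 0"
proof -
  have gi: "integrable freq_domain g" using g by (simp add: fourier_annihilated_def)
  have ind: "integrable freq_domain (\<lambda>w. indicator A w *\<^sub>R g w)" if "A \<in> sets borel" for A
  proof (rule Bochner_Integration.integrable_bound)
    show "integrable freq_domain (\<lambda>w. cmod (g w))" using gi by simp
    have [measurable]: "A \<in> sets borel" "g \<in> borel_measurable freq_domain" using that gi by auto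
    show "(\<lambda>w. indicator A w *\<^sub>R g w) \<in> borel_measurable freq_domain" by measurable
  qed (auto simp: indicator_def)
  have zero: "(\<integral>w. indicator A w *\<^sub>R g w \<partial>freq_domain) = 0" if "A \<in> sets borel" for A
  proof -
    have "Int_stable {S::real set. closed S}" by (auto simp: Int_stable_def)
    moreover have "{S::real set. closed S} \<subseteq> Pow UNIV" by auto
    moreover have "A \<in> sigma_sets UNIV {S. closed S}"
      using that by (simp add: borel_eq_closed)
    ultimately show ?thesis
    proof (induction rule: sigma_sets_induct_disjoint)
      case (basic A)
      then show ?case using fourier_annihilated_closed[OF g] by simp
    next
      case empty
      then show ?case by simp
    next
      case (compl A)
      then have [measurable]: "A \<in> sets borel" by (simp add: borel_eq_closed)
      have "(\<integral>w. indicator (UNIV - A) w *\<^sub>R g w \<partial>freq_domain) =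
        (\<integral>w. indicator UNIV w *\<^sub>R g w - indicator A w *\<^sub>R g w \<partial>freq_domain)"
        by (rule Bochner_Integration.integral_cong) (auto simp: indicator_def)
      also have "\<dots> = 0"
        using compl(2) fourier_annihilated_closed[OF g closed_UNIV]
        by (subst Bochner_Integration.integral_diff) (auto intro!: ind gi)
      finally show ?case .
    next
      case (union A)
      then have [measurable]: "A i \<in> sets borel" for i by (auto simp: borel_eq_closed)
      \<comment> \<open>The sigma-algebra of \<open>freq_domain\<close> contains only subsets of the
        interval, so countable additivity is applied to the sets cut down to it; the integrals are
        unchanged.\<close>
      have "(\<integral>w. indicator (\<Union>i. A i) w *\<^sub>R g w \<partial>freq_domain) =
        (\<Sum>i. \<integral>w\<in>A i \<inter> {-pi..pi}. g w \<partial>freq_domain)"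
      proof -
        have "(\<integral>w. indicator (\<Union>i. A i) w *\<^sub>R g w \<partial>freq_domain) =
          (\<integral>w\<in>(\<Union>i. A i \<inter> {-pi..pi}). g w \<partial>freq_domain)"
          unfolding set_lebesgue_integral_def
          by (rule Bochner_Integration.integral_cong) (auto simp: indicator_def)
        also have "\<dots> = (\<Sum>i. \<integral>w\<in>A i \<inter> {-pi..pi}. g w \<partial>freq_domain)"
        proof (rule lebesgue_integral_countable_add)
          show sets: "A i \<inter> {-pi..pi} \<in> sets freq_domain" for i
            unfolding sets_freq_domain sets_restrict_space by auto
          show "(A i \<inter> {-pi..pi}) \<inter> (A j \<inter> {-pi..pi}) = {}" if "i \<noteq> j" for i j
            using union(1) that by (auto simp: disjoint_family_on_def)
          show "set_integrable freq_domain (\<Union>i. A i \<inter> {-pi..pi}) g"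
            unfolding set_integrable_def by (intro integrable_mult_indicator gi sets.countable_UN) (use sets in auto)
        qed
        finally show ?thesis .
      qed
      moreover have "(\<integral>w\<in>A i \<inter> {-pi..pi}. g w \<partial>freq_domain) = (\<integral>w. indicator (A i) w *\<^sub>R g w \<partial>freq_domain)" for i
        unfolding set_lebesgue_integral_def
        by (rule Bochner_Integration.integral_cong) (auto simp: indicator_def)
      ultimately show ?case using union by simp
    qed
  qed
  show ?thesis
  proof (rule sigma_finite_measure.density_unique_banach)
    show "sigma_finite_measure freq_domain"
      using finite_measure_freq_domain by (rule finite_measure.axioms)
    show "integrable freq_domain g" by fact
    show "integrable freq_domain (\<lambda>w. 0::complex)" by simp
    fix A assume "A \<in> sets freq_domain"
    then obtain B where B: "B \<in> sets borel" "A = {-pi..pi} \<inter> B"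
      by (auto simp: sets_freq_domain sets_restrict_space)
    have "(\<integral>w\<in>A. g w \<partial>freq_domain) = (\<integral>w. indicator A w *\<^sub>R g w \<partial>freq_domain)"
      by (simp add: set_lebesgue_integral_def)
    also have "\<dots> = 0" by (rule zero) (use B in auto)
    finally show "(\<integral>w\<in>A. g w \<partial>freq_domain) = (\<integral>w\<in>A. 0 \<partial>freq_domain)"
      by (simp add: set_lebesgue_integral_def)
  qed
qed

theorem fourier_coefficients_unique:
  assumes "integrable freq_domain f" "integrable freq_domain g"
    and eq: "\<And>u::int. (\<integral>w. exp (\<i> * complex_of_real (real_of_int u * w)) * f w \<partial>freq_domain) =
      (\<integral>w. exp (\<i> * complex_of_real (real_of_int u * w)) * g w \<partial>freq_domain)"
  shows "AE w in freq_domain. f w = g w"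
proof -
  have int: "integrable freq_domain (\<lambda>w. cis (of_int u * w) * f w)" "integrable freq_domain (\<lambda>w. cis (of_int u * w) * g w)" for u :: int
    using assms by (auto intro!: integrable_bounded_mult[where K=1])
  have "fourier_annihilated (\<lambda>w. f w - g w)"
    using assms(1,2) int eq[folded cis_conv_exp] by (simp add: fourier_annihilated_def right_diff_distrib)
  from fourier_annihilated_AE_zero[OF this] show ?thesis by simp
qed

section \<open>The Fourier transform of the Matern spectral density\<close>

text \<open>This is the characteristic function of the standard normal distribution after a change
  of scale.\<close>

lemma fourier_gaussian_real:
  assumes "\<tau> > 0"
  shows "has_bochner_integral lborel (\<lambda>x. exp (\<i> * of_real (\<eta> * x)) * complex_of_real (exp (- \<tau> * x\<^sup>2)))
    (of_real (sqrt (pi / \<tau>) * exp (- \<eta>\<^sup>2 / (4 * \<tau>))))"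
proof -
  \<comment> \<open>The scale \<open>c\<close> satisfies
    \<open>(c * x)^2 / 2 = \<tau> * x^2\<close>, so the standard normal density at
    \<open>c * x\<close> is the given Gaussian up to the factor
    \<open>sqrt (2 * pi)\<close>.\<close>
  define c where "c = sqrt (2 * \<tau>)"
  have c: "c > 0" "c\<^sup>2 = 2 * \<tau>" using assms by (auto simp: c_def)
  let ?f = "\<lambda>x. std_normal_density x *\<^sub>R iexp (\<eta> / c * x)"
  have "prob_space std_normal_distribution"
    by (rule real_distribution.axioms(1)[OF real_dist_normal_dist])
  then have "integrable std_normal_distribution (\<lambda>x. iexp (\<eta> / c * x))"
    by (intro prob_space.integrable_iexp) auto
  then have int: "integrable lborel ?f"
    by (subst (asm) integrable_density) auto
  have "(\<integral>x. ?f x \<partial>lborel) = char std_normal_distribution (\<eta> / c)"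
    unfolding char_def by (subst integral_density) auto
  also have "\<dots> = of_real (exp (- \<eta>\<^sup>2 / (4 * \<tau>)))"
    using c by (simp add: char_std_normal_distribution power_divide)
  finally have "has_bochner_integral lborel ?f (of_real (exp (- \<eta>\<^sup>2 / (4 * \<tau>))))"
    using int by (simp add: has_bochner_integral_iff)
  then have "has_bochner_integral lborel (\<lambda>x. ?f (0 + c * x)) (of_real (exp (- \<eta>\<^sup>2 / (4 * \<tau>))) /\<^sub>R \<bar>c\<bar>)"
    using lborel_has_bochner_integral_real_affine_iff[of c ?f _ 0] c by blast
  then have "has_bochner_integral lborel (\<lambda>x. complex_of_real (sqrt (2 * pi)) * ?f (0 + c * x))
     (complex_of_real (sqrt (2 * pi)) * (of_real (exp (- \<eta>\<^sup>2 / (4 * \<tau>))) /\<^sub>R \<bar>c\<bar>))"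
    by (rule has_bochner_integral_mult_right)
  moreover have "complex_of_real (sqrt (2 * pi)) * ?f (0 + c * x) =
    exp (\<i> * of_real (\<eta> * x)) * complex_of_real (exp (- \<tau> * x\<^sup>2))" for x
  proof -
    have "sqrt (2 * pi) * std_normal_density (c * x) = exp (- \<tau> * x\<^sup>2)"
      unfolding std_normal_density_def power_mult_distrib c(2) by simp
    then have "complex_of_real (sqrt (2 * pi)) * complex_of_real (std_normal_density (c * x)) =
        complex_of_real (exp (- \<tau> * x\<^sup>2))"
      by (simp only: flip: of_real_mult)
    moreover have "\<eta> / c * (0 + c * x) = \<eta> * x" using c by simp
    ultimately show ?thesis
      by (simp only: scaleR_conv_of_real add_0_left mult.assoc[symmetric]) (simp only: mult.commute)
  qed
  moreover have "complex_of_real (sqrt (2 * pi)) * (of_real (exp (- \<eta>\<^sup>2 / (4 * \<tau>))) /\<^sub>R \<bar>c\<bar>) =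
    of_real (sqrt (pi / \<tau>) * exp (- \<eta>\<^sup>2 / (4 * \<tau>)))"
  proof -
    have "sqrt (pi / \<tau>) = sqrt ((2 * pi) / (2 * \<tau>))" by simp
    then have "sqrt (2 * pi) / c = sqrt (pi / \<tau>)"
      unfolding c_def by (simp only: real_sqrt_divide)
    then have eq: "sqrt (2 * pi) * (inverse \<bar>c\<bar> * exp (- \<eta>\<^sup>2 / (4 * \<tau>))) = sqrt (pi / \<tau>) * exp (- \<eta>\<^sup>2 / (4 * \<tau>))"
      using c by (simp only: divide_inverse mult.assoc[symmetric] abs_of_pos)
    show ?thesis
      unfolding eq[symmetric] of_real_mult scaleR_conv_of_real ..
  qed
  ultimately show ?thesis by (simp only:)
qed

text \<open>Both the character and the Gaussian factor over the coordinates, and Lebesgue measure is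
  the image of the product of its one-dimensional copies, so the integral is a product of
  one-dimensional transforms.\<close>

lemma fourier_gaussian:
  fixes h :: "'a::euclidean_space"
  assumes "\<tau> > 0"
  shows "(\<integral>l. exp (\<i> * of_real (h \<bullet> l)) * complex_of_real (exp (- \<tau> * (norm l)\<^sup>2)) \<partial>lborel) =
    of_real (sqrt (pi / \<tau>) ^ DIM('a) * exp (- (norm h)\<^sup>2 / (4 * \<tau>)))"
proof -
  interpret product_sigma_finite "\<lambda>b::'a. lborel :: real measure"
    by (rule product_sigma_finite.intro) (rule lborel.sigma_finite_measure_axioms)
  define F where "F b x = exp (\<i> * of_real ((h \<bullet> b) * x)) * complex_of_real (exp (- \<tau> * x\<^sup>2))" for b x
  have F: "has_bochner_integral lborel (F b) (of_real (sqrt (pi / \<tau>) * exp (- (h \<bullet> b)\<^sup>2 / (4 * \<tau>))))" for b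
    unfolding F_def by (rule fourier_gaussian_real[OF assms])
  have norm2: "(norm x)\<^sup>2 = (\<Sum>b\<in>Basis. (x \<bullet> b)\<^sup>2)" for x :: 'a
    by (subst power2_norm_eq_inner, subst euclidean_inner) (simp add: power2_eq_square)
  have prod: "exp (\<i> * of_real (h \<bullet> l)) * complex_of_real (exp (- \<tau> * (norm l)\<^sup>2)) = (\<Prod>b\<in>Basis. F b (l \<bullet> b))" for l
    unfolding F_def norm2 euclidean_inner[of h l] prod.distrib
    by (simp add: sum_distrib_left exp_sum flip: of_real_prod sum_negf)
  have [measurable]: "F b \<in> borel_measurable borel" for b
    unfolding F_def by measurable
  have "(\<integral>l. exp (\<i> * of_real (h \<bullet> l)) * complex_of_real (exp (- \<tau> * (norm l)\<^sup>2)) \<partial>lborel) =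
    (\<integral>l. (\<Prod>b\<in>Basis. F b (l \<bullet> b)) \<partial>distr (\<Pi>\<^sub>M b\<in>Basis. lborel) borel (\<lambda>f. \<Sum>b\<in>Basis. f b *\<^sub>R b))"
    unfolding prod lborel_eq[symmetric] ..
  also have "\<dots> = (\<integral>f. (\<Prod>b\<in>Basis. F b (f b)) \<partial>(\<Pi>\<^sub>M b\<in>(Basis::'a set). lborel))"
    by (subst integral_distr) (auto intro!: Bochner_Integration.integral_cong prod.cong)
  also have "\<dots> = (\<Prod>b\<in>(Basis::'a set). \<integral>x. F b x \<partial>lborel)"
    using F by (intro product_integral_prod) (auto simp: has_bochner_integral_iff)
  also have "\<dots> = (\<Prod>b\<in>(Basis::'a set). of_real (sqrt (pi / \<tau>) * exp (- (h \<bullet> b)\<^sup>2 / (4 * \<tau>))))"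
    using F by (intro prod.cong) (auto simp: has_bochner_integral_iff)
  also have "\<dots> = of_real (sqrt (pi / \<tau>) ^ DIM('a) * exp (\<Sum>b\<in>(Basis::'a set). - (h \<bullet> b)\<^sup>2 / (4 * \<tau>)))"
    by (simp add: prod.distrib exp_sum flip: of_real_prod)
  also have "(\<Sum>b\<in>(Basis::'a set). - (h \<bullet> b)\<^sup>2 / (4 * \<tau>)) = - (norm h)\<^sup>2 / (4 * \<tau>)"
    by (simp add: norm2 sum_negf flip: sum_divide_distrib)
  finally show ?thesis .
qed

text \<open>The substitution \<open>t = r * exp s\<close> moves Euler's integral for Gamma from the
  half-line to the whole line. The extended nonnegative form delivers integrability and value at the
  same time.\<close>

lemma Gamma_nn_integral_exp:
  assumes a: "a > 0" and r: "r > (0::real)"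
  shows "(\<integral>\<^sup>+s. ennreal (exp (a * s) * exp (- r * exp s)) \<partial>lborel) = ennreal (Gamma a * r powr (-a))"
proof -
  let ?g = "\<lambda>t. t powr (a - 1) / exp t"
  let ?f = "\<lambda>s. exp (a * s) * exp (- r * exp s)"
  have im: "range (\<lambda>s. r * exp s) = {0<..}"
  proof safe
    fix t :: real assume "t > 0"
    then show "t \<in> range (\<lambda>s. r * exp s)"
      using r by (intro image_eqI[of _ _ "ln (t / r)"]) auto
  qed (use r in auto)
  \<comment> \<open>Euler's integral is over the closed half-line, while the substitution reaches
    only the open one; the point 0 is negligible.\<close>
  have "(?g has_integral Gamma a) {0<..}"
    using Gamma_integral_real[OF a]
    by (rule has_integral_spike_set_eq[THEN iffD1, rotated 2])
      (auto intro: negligible_subset[OF negligible_sing[of "0::real"]])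
  then have "?g absolutely_integrable_on (range (\<lambda>s. r * exp s)) \<and> integral (range (\<lambda>s. r * exp s)) ?g = Gamma a"
    unfolding im by (auto intro!: nonnegative_absolutely_integrable_1 integral_unique)
  then have "(\<lambda>s. \<bar>r * exp s\<bar> * ?g (r * exp s)) absolutely_integrable_on UNIV \<and>
      integral UNIV (\<lambda>s. \<bar>r * exp s\<bar> * ?g (r * exp s)) = Gamma a"
    using r by (subst has_absolute_integral_change_of_variables_1')
      (auto simp: inj_on_def intro!: derivative_eq_intros)
  moreover have "\<bar>r * exp s\<bar> * ?g (r * exp s) = r powr a * ?f s" for s
  proof -
    have "(r * exp s) * (r * exp s) powr (a - 1) = (r * exp s) powr a"
      using r by (simp add: powr_diff)
    also have "\<dots> = r powr a * exp (a * s)"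
      using r by (simp add: powr_mult powr_def[of "exp s"])
    finally show ?thesis using r by (simp add: exp_minus field_simps)
  qed
  ultimately have "(\<lambda>s. r powr a * ?f s) integrable_on UNIV \<and> integral UNIV (\<lambda>s. r powr a * ?f s) = Gamma a"
    using set_lebesgue_integral_eq_integral(1) by auto
  then have "((\<lambda>s. r powr a * ?f s) has_integral Gamma a) UNIV"
    by (metis integrable_integral)
  from has_integral_mult_right[OF this, of "r powr (-a)"]
  have "(?f has_integral (Gamma a * r powr (-a))) UNIV"
    using r by (simp add: powr_minus field_simps)
  from nn_integral_has_integral_lebesgue'[OF _ this] show ?thesis by simp
qed

text \<open>Folding the line at 0 pairs \<open>s\<close> with \<open>-s\<close>: \<open>cosh\<close>
  is even, and the two factors \<open>exp (\<mu> * s)\<close> and \<open>exp (- \<mu> * s)\<close>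
  add up to \<open>2 * cosh (\<mu> * s)\<close>.\<close>

lemma bessel_K_whole_line:
  assumes "integrable lborel (\<lambda>s. exp (\<mu> * s) * exp (- x * cosh s))"
  shows "(\<integral>s. exp (\<mu> * s) * exp (- x * cosh s) \<partial>lborel) = 2 * bessel_K \<mu> x"
proof -
  let ?f = "\<lambda>s. exp (\<mu> * s) * exp (- x * cosh s)"
  have [measurable]: "(cosh :: real \<Rightarrow> real) \<in> borel_measurable borel"
    by (intro borel_measurable_continuous_onI continuous_intros)
  have int: "integrable lborel ?f" by fact
  have int': "integrable lborel (\<lambda>s. ?f (-s))"
    using lborel_integrable_real_affine[OF int, of "-1" 0] by simp
  have ip: "integrable lborel (\<lambda>s. indicator {0..} s *\<^sub>R ?f s)" "integrable lborel (\<lambda>s. indicator {0..} s *\<^sub>R ?f (-s))"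
    "integrable lborel (\<lambda>s. indicator {..<0} s *\<^sub>R ?f s)"
    by (intro integrable_mult_indicator int int'; simp)+
  have "(\<integral>s. ?f s \<partial>lborel) = (\<integral>s. indicator {0..} s *\<^sub>R ?f s + indicator {..<0} s *\<^sub>R ?f s \<partial>lborel)"
    by (rule Bochner_Integration.integral_cong) (auto simp: indicator_def)
  also have "\<dots> = (\<integral>s. indicator {0..} s *\<^sub>R ?f s \<partial>lborel) + (\<integral>s. indicator {..<0} s *\<^sub>R ?f s \<partial>lborel)"
    by (rule Bochner_Integration.integral_add[OF ip(1,3)])
  also have "(\<integral>s. indicator {..<0} s *\<^sub>R ?f s \<partial>lborel) = (\<integral>s. indicator {..<0} (-s) *\<^sub>R ?f (-s) \<partial>lborel)"
    using lborel_integral_real_affine[of "-1" "\<lambda>s. indicator {..<0} s *\<^sub>R ?f s" 0] by simp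
  \<comment> \<open>After the reflection, the two half-lines differ only by the point 0.\<close>
  also have "\<dots> = (\<integral>s. indicator {0..} s *\<^sub>R ?f (-s) \<partial>lborel)"
  proof (rule integral_cong_AE)
    show "AE s in lborel. indicator {..<0} (-s) *\<^sub>R ?f (-s) = indicator {0..} s *\<^sub>R ?f (-s)"
      using AE_lborel_singleton[of "0::real"] by eventually_elim (auto simp: indicator_def)
  qed auto
  also have "(\<integral>s. indicator {0..} s *\<^sub>R ?f s \<partial>lborel) + (\<integral>s. indicator {0..} s *\<^sub>R ?f (-s) \<partial>lborel) =
    (\<integral>s. 2 * (indicator {0..} s *\<^sub>R (exp (- x * cosh s) * cosh (\<mu> * s))) \<partial>lborel)"
  proof (subst Bochner_Integration.integral_add[OF ip(1,2), symmetric], intro Bochner_Integration.integral_cong refl)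
    fix s
    have "exp (\<mu> * s) + exp (\<mu> * (-s)) = 2 * cosh (\<mu> * s)"
      by (simp add: cosh_field_def)
    then have "?f s + ?f (-s) = 2 * (exp (- x * cosh s) * cosh (\<mu> * s))"
      unfolding cosh_minus by (simp only: distrib_right[symmetric] mult.assoc mult.commute[of "exp (- x * cosh s)"])
    then show "indicator {0..} s *\<^sub>R ?f s + indicator {0..} s *\<^sub>R ?f (-s) =
      2 * (indicator {0..} s *\<^sub>R (exp (- x * cosh s) * cosh (\<mu> * s)))"
      by (simp add: indicator_def)
  qed
  also have "\<dots> = 2 * bessel_K \<mu> x"
    by (simp add: bessel_K_def set_lebesgue_integral_def)
  finally show ?thesis .
qed

text \<open>The integrability hypothesis amounts to \<open>2 * a > DIM('a)\<close>.\<close>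

theorem fourier_matern:
  fixes h :: "'a::euclidean_space"
  assumes a: "a > 0" and q: "q > 0" and h: "h \<noteq> 0"
    and int: "integrable lborel (\<lambda>l::'a. ((norm l)\<^sup>2 + q\<^sup>2) powr (-a))"
  shows "(\<integral>l. exp (\<i> * of_real (h \<bullet> l)) * complex_of_real (((norm l)\<^sup>2 + q\<^sup>2) powr (-a)) \<partial>lborel) =
    of_real (2 * pi powr (DIM('a) / 2) / Gamma a * (norm h / (2 * q)) powr (a - DIM('a) / 2) *
      bessel_K (a - DIM('a) / 2) (norm h * q))"
proof -
  define r where "r l = (norm l)\<^sup>2 + q\<^sup>2" for l :: 'a
  have r: "r l > 0" for l using q by (auto simp: r_def intro: add_nonneg_pos)
  have [measurable]: "r \<in> borel_measurable borel" unfolding r_def by measurable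
  define \<mu> where "\<mu> = a - DIM('a) / 2"
  define k where "k l s = exp (a * s) * exp (- r l * exp s)" for l s
  have k_nonneg: "k l s \<ge> 0" for l s by (simp add: k_def)
  have [measurable]: "case_prod k \<in> borel_measurable (lborel \<Otimes>\<^sub>M lborel)"
    unfolding k_def by measurable
  have [measurable]: "k l \<in> borel_measurable borel" for l unfolding k_def by measurable
  have nnk: "(\<integral>\<^sup>+s. ennreal (k l s) \<partial>lborel) = ennreal (Gamma a * r l powr (-a))" for l
    unfolding k_def by (rule Gamma_nn_integral_exp[OF a r])
  have ik: "integrable lborel (k l)" for l
    by (rule integrableI_nonneg) (auto simp: nnk k_nonneg)
  have Ik: "(\<integral>s. k l s \<partial>lborel) = Gamma a * r l powr (-a)" for l
    using nnk[of l] by (intro integral_eq_nn_integral[THEN trans]) (auto simp: k_nonneg Gamma_real_pos a intro!: mult_nonneg_nonneg less_imp_le)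
  define H where "H l s = exp (\<i> * of_real (h \<bullet> l)) * complex_of_real (k l s)" for l s
  have [measurable]: "case_prod H \<in> borel_measurable (lborel \<Otimes>\<^sub>M lborel)"
    unfolding H_def k_def split_beta' by measurable
  \<comment> \<open>The modulus of \<open>H\<close> is \<open>k\<close>, and the total integral of
    \<open>k\<close> is \<open>Gamma a\<close> times the integral of the power of \<open>r\<close>,
    finite by hypothesis. This justifies exchanging the integrals of \<open>H\<close>.\<close>
  have "integrable (lborel \<Otimes>\<^sub>M lborel) (case_prod k)"
  proof (rule integrableI_nonneg)
    have "(\<integral>\<^sup>+p. ennreal (case_prod k p) \<partial>(lborel \<Otimes>\<^sub>M lborel)) = (\<integral>\<^sup>+l. \<integral>\<^sup>+s. ennreal (k l s) \<partial>lborel \<partial>lborel)"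
      by (subst lborel.nn_integral_fst[symmetric]) auto
    also have "\<dots> = (\<integral>\<^sup>+l. ennreal (Gamma a * r l powr (-a)) \<partial>lborel)"
      by (simp add: nnk)
    also have "\<dots> < \<infinity>"
      using int Gamma_real_pos[OF a]
      by (auto simp: integrable_iff_bounded r_def ennreal_mult' nn_integral_cmult ennreal_mult_less_top)
    finally show "(\<integral>\<^sup>+p. ennreal (case_prod k p) \<partial>(lborel \<Otimes>\<^sub>M lborel)) < \<infinity>" .
  qed (auto simp: k_nonneg)
  then have iH: "integrable (lborel \<Otimes>\<^sub>M lborel) (case_prod H)"
    by (rule Bochner_Integration.integrable_bound)
      (auto simp: H_def norm_mult k_nonneg)
  \<comment> \<open>The Gaussian transform with parameter \<open>exp s\<close> contributes a factor
    \<open>exp (- DIM('a) / 2 * s)\<close>, which lowers the exponent from \<open>a\<close> to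
    \<open>\<mu>\<close>, and the term with \<open>exp (-s)\<close>.\<close>
  define w where "w s = exp (\<mu> * s) * exp (- (q\<^sup>2 * exp s + (norm h)\<^sup>2 * exp (-s) / 4))" for s
  define p where "p = pi powr (DIM('a) / 2)"
  have inner: "(\<integral>l. H l s \<partial>lborel) = of_real (p * w s)" for s
  proof -
    have eq: "H l s = of_real (exp (a * s) * exp (- q\<^sup>2 * exp s)) *
        (exp (\<i> * of_real (h \<bullet> l)) * complex_of_real (exp (- exp s * (norm l)\<^sup>2)))" for l
    proof -
      have "a * s + - r l * exp s = (a * s + - q\<^sup>2 * exp s) + - exp s * (norm l)\<^sup>2"
        by (simp add: r_def algebra_simps)
      then have keq: "k l s = (exp (a * s) * exp (- q\<^sup>2 * exp s)) * exp (- exp s * (norm l)\<^sup>2)"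
        by (simp only: k_def exp_add[symmetric])
      show ?thesis unfolding H_def keq by simp
    qed
    have "(\<integral>l. H l s \<partial>lborel) = of_real (exp (a * s) * exp (- q\<^sup>2 * exp s)) *
        of_real (sqrt (pi / exp s) ^ DIM('a) * exp (- (norm h)\<^sup>2 / (4 * exp s)))"
      unfolding eq by (simp only: integral_mult_right_zero fourier_gaussian[OF exp_gt_zero])
    also have "\<dots> = of_real (p * w s)"
    proof -
      have "sqrt (pi / exp s) ^ DIM('a) = (pi / exp s) powr (DIM('a) / 2)"
      proof -
        have "sqrt (pi / exp s) ^ DIM('a) = ((pi / exp s) powr (1 / 2)) powr real DIM('a)"
          by (subst powr_half_sqrt) (auto simp: powr_realpow)
        then show ?thesis by (simp add: powr_powr)
      qed
      also have "\<dots> = p * exp (- (DIM('a) / 2 * s))"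
        by (simp add: p_def powr_divide powr_def[of "exp s"] exp_minus field_simps)
      finally have eq: "sqrt (pi / exp s) ^ DIM('a) = p * exp (- (DIM('a) / 2 * s))" .
      have "a * s - q\<^sup>2 * exp s + (- (DIM('a) / 2 * s) + - (norm h)\<^sup>2 / (4 * exp s)) =
          \<mu> * s + - (q\<^sup>2 * exp s + (norm h)\<^sup>2 * exp (-s) / 4)"
        by (simp add: \<mu>_def exp_minus field_simps)
      then have "exp (a * s) * exp (- q\<^sup>2 * exp s) * (exp (- (DIM('a) / 2 * s)) * exp (- (norm h)\<^sup>2 / (4 * exp s))) = w s"
        by (simp add: w_def flip: exp_add)
      then have "exp (a * s) * exp (- q\<^sup>2 * exp s) * (p * exp (- (DIM('a) / 2 * s)) * exp (- (norm h)\<^sup>2 / (4 * exp s))) = p * w s"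
        by (metis mult.assoc mult.left_commute)
      then show ?thesis
        unfolding eq by (simp only: of_real_mult[symmetric])
    qed
    finally show ?thesis .
  qed
  define x where "x = norm h * q"
  \<comment> \<open>At \<open>s0\<close> the terms \<open>q^2 * exp s0\<close> and
    \<open>(norm h)^2 * exp (- s0) / 4\<close> are both equal to \<open>norm h * q / 2\<close>.
    Centred there, their sum becomes \<open>x * cosh s\<close>.\<close>
  define s0 where "s0 = ln (norm h / (2 * q))"
  have s0: "exp s0 = norm h / (2 * q)" "exp (\<mu> * s0) = (norm h / (2 * q)) powr \<mu>"
    using h q by (auto simp: s0_def powr_def)
  have shift: "w (s0 + 1 * s) = exp (\<mu> * s0) * (exp (\<mu> * s) * exp (- x * cosh s))" for s
  proof -
    have e: "exp (- (s0 + s)) = 2 * q / norm h * exp (- s)"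
      unfolding exp_minus exp_add s0 using h q by (simp add: field_simps)
    have "q\<^sup>2 * exp (s0 + s) + (norm h)\<^sup>2 * exp (- (s0 + s)) / 4 = x * cosh s"
      unfolding e using h q by (simp add: exp_add s0 x_def cosh_field_def power2_eq_square field_simps)
    then show ?thesis by (simp add: w_def distrib_left exp_add)
  qed
  \<comment> \<open>Fubini's theorem also makes the inner integral integrable in \<open>s\<close>.
    Convergence of the Bessel integral therefore follows from the integrability hypothesis without
    separate estimates.\<close>
  have "integrable lborel (\<lambda>s. complex_of_real (p * w s))"
    using lborel_pair.integrable_snd[OF iH] by (simp add: inner)
  then have "integrable lborel (\<lambda>s. p * w s)"
    by (simp only: complex_of_real_integrable_eq)
  then have "integrable lborel w" by (simp add: p_def)
  then have "integrable lborel (\<lambda>s. w (s0 + 1 * s))"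
    by (rule lborel_integrable_real_affine) simp
  then have iK: "integrable lborel (\<lambda>s. exp (\<mu> * s) * exp (- x * cosh s))"
    unfolding shift by simp
  have "(\<integral>s. w s \<partial>lborel) = (\<integral>s. w (s0 + 1 * s) \<partial>lborel)"
    using lborel_integral_real_affine[of 1 w s0] by simp
  also have "\<dots> = exp (\<mu> * s0) * (2 * bessel_K \<mu> x)"
    unfolding shift by (simp only: integral_mult_right_zero bessel_K_whole_line[OF iK])
  finally have Iw: "(\<integral>s. w s \<partial>lborel) = exp (\<mu> * s0) * (2 * bessel_K \<mu> x)" .
  have "of_real (Gamma a) * (\<integral>l. exp (\<i> * of_real (h \<bullet> l)) * complex_of_real (r l powr (-a)) \<partial>lborel) =
    (\<integral>l. (\<integral>s. H l s \<partial>lborel) \<partial>lborel)"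
    unfolding H_def integral_mult_right_zero[symmetric]
    by (intro Bochner_Integration.integral_cong refl)
      (simp add: Ik mult.left_commute)
  also have "\<dots> = (\<integral>s. (\<integral>l. H l s \<partial>lborel) \<partial>lborel)"
    using lborel_pair.Fubini_integral[OF iH] by simp
  also have "\<dots> = of_real (p * (exp (\<mu> * s0) * (2 * bessel_K \<mu> x)))"
    by (simp only: inner integral_complex_of_real integral_mult_right_zero Iw)
  finally have "(\<integral>l. exp (\<i> * of_real (h \<bullet> l)) * complex_of_real (r l powr (-a)) \<partial>lborel) =
      of_real (p * (exp (\<mu> * s0) * (2 * bessel_K \<mu> x)) / Gamma a)"
    using Gamma_real_pos[OF a] by (simp add: field_simps)
  also have "p * (exp (\<mu> * s0) * (2 * bessel_K \<mu> x)) / Gamma a =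
      2 * p / Gamma a * (norm h / (2 * q)) powr \<mu> * bessel_K \<mu> x"
    unfolding s0(2) by simp
  finally show ?thesis
    unfolding r_def p_def x_def \<mu>_def .
qed

section \<open>Spectral density and cross spectrum\<close>

lemma pair_sigma_finite_spectral_domain:
  "pair_sigma_finite (lborel :: (real ^ 'd) measure) freq_domain"
proof -
  interpret F: finite_measure freq_domain by (rule finite_measure_freq_domain)
  show ?thesis ..
qed

lemma sigma_finite_spectral_domain:
  "sigma_finite_measure (spectral_domain :: ((real ^ 'd) \<times> real) measure)"
proof -
  interpret pair_sigma_finite "lborel :: (real ^ 'd) measure" freq_domain
    by (rule pair_sigma_finite_spectral_domain)
  show ?thesis unfolding spectral_domain_def by (rule sigma_finite_measure_axioms)
qed

lemma space_spectral_domain: "space (spectral_domain :: ((real ^ 'd) \<times> real) measure) = UNIV \<times> {-pi..pi}"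
  by (simp add: spectral_domain_def space_pair_measure)

lemma norm_power2_eq_sum: "(norm (l :: real ^ 'd))\<^sup>2 = (\<Sum>i\<in>UNIV. (l $ i)\<^sup>2)"
  by (simp add: power2_norm_eq_inner inner_vec_def flip: power2_eq_square)

text \<open>Every logarithm of the negative number \<open>- r\<close> has real part
  \<open>ln r\<close>. Since \<open>\<nu>\<close> is real, the imaginary part, and with it the
  branch, affects only the phase.\<close>

lemma norm_operator_symbol:
  assumes "cmod (c w) > 0"
  shows "cmod (operator_symbol k c \<nu> (l, w)) = ((norm l)\<^sup>2 + (cmod (c w))\<^sup>2) powr \<nu>"
proof -
  define r where "r = (norm l)\<^sup>2 + (cmod (c w))\<^sup>2"
  have r: "r > 0" using assms by (auto simp: r_def intro: add_nonneg_pos)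
  have eq: "- (\<Sum>i\<in>UNIV. (l $ i)\<^sup>2) - (cmod (c w))\<^sup>2 = - r"
    by (simp add: r_def norm_power2_eq_sum)
  have "cmod (operator_symbol k c \<nu> (l, w)) = exp (\<nu> * Re (Ln (complex_of_real (- r))))"
    unfolding operator_symbol_def prod.case eq by (simp add: Re_complex_of_real)
  also have "\<dots> = r powr \<nu>"
    using r by (simp add: powr_def)
  finally show ?thesis by (simp add: r_def)
qed

text \<open>The equation speaks about bounded sets only, so the densities of the two second moments
  are first identified over each ball of wave numbers; countably many balls exhaust the space.
  Extended nonnegative densities allow the comparison although white noise has infinite total mass
  when \<sigma> is not 0.\<close>

lemma spectral_density_from_spde:
  fixes f :: "(real ^ 'd) \<times> real \<Rightarrow> real"
  assumes n: "n \<ge> 1"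
    and f: "integrable spectral_domain f" and f_nonneg: "AE p in spectral_domain. f p \<ge> 0"
    and ZY: "orthogonal_increments M (spectral_measure f) Z\<^sub>Y"
    and Ze: "orthogonal_increments M (white_noise_spectrum \<sigma>) Z\<^sub>e"
    and c_meas: "c \<in> borel_measurable freq_domain"
    and c: "\<And>w. w \<in> {-pi..pi} \<Longrightarrow> cmod (c w) > 0"
    and spde: "satisfies_fractional_spde M (spectral_measure f) Z\<^sub>Y (white_noise_spectrum \<sigma>) Z\<^sub>e n k c \<nu>"
  shows "AE (l, w) in spectral_domain.
    f (l, w) = \<sigma>\<^sup>2 / (2 * pi) ^ CARD('d) * ((norm l)\<^sup>2 + (cmod (c w))\<^sup>2) powr (- (2 * \<nu>))"
proof -
  interpret sigma_finite_measure "spectral_domain :: ((real ^ 'd) \<times> real) measure"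
    by (rule sigma_finite_spectral_domain)
  define r where "r p = (norm (fst p))\<^sup>2 + (cmod (c (snd p)))\<^sup>2" for p :: "(real ^ 'd) \<times> real"
  define C where "C = \<sigma>\<^sup>2 / (2 * pi) ^ CARD('d)"
  define \<kappa> where "\<kappa> = real n / (2 * pi)"
  have \<kappa>: "\<kappa> > 0" using n by (simp add: \<kappa>_def)
  have C: "C \<ge> 0" by (simp add: C_def)
  have r: "r p > 0" if "p \<in> space spectral_domain" for p
    using c[of "snd p"] that by (auto simp: r_def space_spectral_domain intro!: add_nonneg_pos)
  have [measurable]: "c \<in> borel_measurable freq_domain" "f \<in> borel_measurable spectral_domain"
    using c_meas f by auto
  have [measurable]: "r \<in> borel_measurable spectral_domain"
    unfolding r_def spectral_domain_def by measurable
  \<comment> \<open>\<open>u\<close> and \<open>v\<close> are the densities of the second moments of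
    the increment in its two representations; \<open>\<kappa>\<close> is the square of the
    normalizing factor of the transform.\<close>
  define u where "u p = ennreal (f p * (r p powr (2 * \<nu>) * \<kappa>))" for p
  define v where "v p = ennreal (C * \<kappa>)" for p :: "(real ^ 'd) \<times> real"
  have [measurable]: "u \<in> borel_measurable spectral_domain" "v \<in> borel_measurable spectral_domain"
    unfolding u_def v_def by measurable
  have eq: "(\<integral>\<^sup>+p\<in>A. u p \<partial>spectral_domain) = (\<integral>\<^sup>+p\<in>A. v p \<partial>spectral_domain)"
    if A[measurable]: "A \<in> sets spectral_domain" and "bounded A" for A
  proof -
    \<comment> \<open>A location enters only through a factor of modulus 1, so second moments at
      \<open>s = 0\<close> suffice.\<close>
    obtain X where X: "dft_increment M (spectral_measure f) Z\<^sub>Y n (operator_symbol k c \<nu>) 0 A X"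
      "dft_increment M (white_noise_spectrum \<sigma>) Z\<^sub>e n (\<lambda>_. 1) 0 A X"
      using spde[unfolded satisfies_fractional_spde_def, rule_format, OF A \<open>bounded A\<close>, of 0] by (elim exE conjE)
    define F where "F m = (\<lambda>(l, w). indicator A (l, w) * m (l, w) * exp (\<i> * complex_of_real (0 \<bullet> l)) *
                 complex_of_real (sqrt (real n / (2 * pi))))" for m :: "(real ^ 'd) \<times> real \<Rightarrow> complex"
    have g2: "(cmod (F m p))\<^sup>2 = indicator A p * ((cmod (m p))\<^sup>2 * \<kappa>)" for m p
      by (cases p, cases "p \<in> A") (simp_all add: F_def \<kappa>_def norm_mult power_mult_distrib)
    \<comment> \<open>The density and the multiplier are kept general, since the same computation
      serves the process and the white noise.\<close>
    have nn: "(\<integral>\<^sup>+x. ennreal ((cmod (X x))\<^sup>2) \<partial>M) =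
        (\<integral>\<^sup>+p. ennreal (h p) * ennreal ((cmod (F m p))\<^sup>2) \<partial>spectral_domain)"
      if "dft_increment M (spectral_measure h) Z n m 0 A X" "orthogonal_increments M (spectral_measure h) Z"
        and [measurable]: "h \<in> borel_measurable spectral_domain"
      for h Z and m :: "(real ^ 'd) \<times> real \<Rightarrow> complex"
    proof -
      have I: "has_stoch_integral M (spectral_measure h) Z (F m) X"
        using that(1) unfolding dft_increment_def F_def .
      then have "F m \<in> borel_measurable (spectral_measure h)"
        unfolding has_stoch_integral_def by blast
      then have gm: "F m \<in> borel_measurable spectral_domain"
        by (simp add: spectral_measure_def)
      have "(\<integral>\<^sup>+p. ennreal ((cmod (g p))\<^sup>2) \<partial>density spectral_domain (\<lambda>p. ennreal (h p))) =
          (\<integral>\<^sup>+p. ennreal (h p) * ennreal ((cmod (g p))\<^sup>2) \<partial>spectral_domain)"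
        if [measurable]: "g \<in> borel_measurable spectral_domain" for g :: "(real ^ 'd) \<times> real \<Rightarrow> complex"
        by (subst nn_integral_density) auto
      from this[OF gm] show ?thesis
        unfolding stoch_integral_norm[OF that(2) I] spectral_measure_def .
    qed
    have "(\<integral>\<^sup>+p\<in>A. u p \<partial>spectral_domain) =
        (\<integral>\<^sup>+p. ennreal (f p) * ennreal ((cmod (F (operator_symbol k c \<nu>) p))\<^sup>2) \<partial>spectral_domain)"
    proof (rule nn_integral_cong)
      fix p :: "(real ^ 'd) \<times> real" assume p: "p \<in> space spectral_domain"
      obtain l w where lw: "p = (l, w)" by (cases p)
      have "(cmod (operator_symbol k c \<nu> p))\<^sup>2 = r p powr (2 * \<nu>)"
        using p c[of w] r[OF p] unfolding lw
        by (subst norm_operator_symbol) (auto simp: space_spectral_domain r_def power2_eq_square simp flip: powr_add)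
      then show "u p * indicator A p = ennreal (f p) * ennreal ((cmod (F (operator_symbol k c \<nu>) p))\<^sup>2)"
        using \<kappa> unfolding g2 by (auto simp: u_def indicator_def ennreal_mult'')
    qed
    also have "\<dots> = (\<integral>\<^sup>+x. ennreal ((cmod (X x))\<^sup>2) \<partial>M)"
      by (rule nn[OF X(1) ZY, symmetric]) simp
    also have "\<dots> = (\<integral>\<^sup>+p. ennreal C * ennreal ((cmod (F (\<lambda>_. 1) p))\<^sup>2) \<partial>spectral_domain)"
      unfolding C_def by (rule nn[OF X(2)[unfolded white_noise_spectrum_def] Ze[unfolded white_noise_spectrum_def]]) simp
    also have "\<dots> = (\<integral>\<^sup>+p\<in>A. v p \<partial>spectral_domain)"
      by (rule nn_integral_cong) (use \<kappa> in \<open>auto simp: g2 v_def indicator_def ennreal_mult''\<close>)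
    finally show ?thesis .
  qed
  have AE_m: "AE p in spectral_domain. norm (fst p) \<le> real m \<longrightarrow> u p = v p" for m
  proof -
    define B where "B = {p \<in> space (spectral_domain :: ((real ^ 'd) \<times> real) measure). norm (fst p) \<le> real m}"
    have [measurable]: "B \<in> sets spectral_domain"
      unfolding B_def spectral_domain_def by measurable
    have "B \<subseteq> cball 0 (real m) \<times> {-pi..pi}" by (auto simp: B_def space_spectral_domain)
    then have bB: "bounded B" by (rule bounded_subset[rotated]) (intro bounded_Times bounded_cball bounded_closed_interval)
    have "AE p in spectral_domain. u p * indicator B p = v p * indicator B p"
    proof (rule density_unique2)
      fix A :: "((real ^ 'd) \<times> real) set" assume [measurable]: "A \<in> sets spectral_domain"
      have "(\<integral>\<^sup>+p\<in>A \<inter> B. u p \<partial>spectral_domain) = (\<integral>\<^sup>+p\<in>A \<inter> B. v p \<partial>spectral_domain)"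
        by (rule eq) (auto intro: bounded_subset[OF bB])
      then show "(\<integral>\<^sup>+p\<in>A. u p * indicator B p \<partial>spectral_domain) = (\<integral>\<^sup>+p\<in>A. v p * indicator B p \<partial>spectral_domain)"
        by (simp add: indicator_inter_arith mult_ac)
    qed measurable
    then show ?thesis
      by (rule AE_mp) (auto simp: B_def indicator_def intro!: AE_I2)
  qed
  have "AE p in spectral_domain. \<forall>m. norm (fst p) \<le> real m \<longrightarrow> u p = v p"
    by (subst AE_all_countable) (intro allI AE_m)
  then have "AE p in spectral_domain. f p = C * r p powr (- (2 * \<nu>))"
    using f_nonneg AE_space
  proof eventually_elim
    case (elim p)
    have "u p = v p" using elim(1) real_arch_simple[of "norm (fst p)"] by blast
    \<comment> \<open>Injectivity of \<open>ennreal\<close> requires nonnegative arguments; for the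
      left one this is the nonnegativity of the spectral density.\<close>
    then have "f p * (r p powr (2 * \<nu>) * \<kappa>) = C * \<kappa>"
      using elim(2) \<kappa> C unfolding u_def v_def by (subst (asm) ennreal_inj) auto
    then have "f p * r p powr (2 * \<nu>) = C" using \<kappa> by simp
    then show ?case using r[OF elim(3)] by (auto simp: powr_minus field_simps)
  qed
  then show ?thesis
    by (auto simp: r_def C_def split_beta')
qed

text \<open>With mean 0 the covariance is an inner product, which the isometry turns into the inner
  product of two characters. The one belonging to time 0 and location 0 is constantly 1.\<close>

lemma cov_fun_spectral:
  fixes f :: "(real ^ 'd) \<times> real \<Rightarrow> real"
  assumes f: "integrable spectral_domain f" and f_nonneg: "AE p in spectral_domain. f p \<ge> 0"
    and mean: "\<And>t s. (\<integral>x. Y t s x \<partial>M) = 0"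
    and Z: "orthogonal_increments M (spectral_measure f) Z"
    and Y: "spectral_representation M (spectral_measure f) Z Y"
  shows "cov_fun M Y h u =
    (\<integral>(l, w). of_real (f (l, w)) * exp (\<i> * of_real (h \<bullet> l + of_int u * w)) \<partial>spectral_domain)"
proof -
  let ?e = "\<lambda>t s (l, w). exp (\<i> * complex_of_real (s \<bullet> l + real_of_int t * w))"
  have I: "has_stoch_integral M (spectral_measure f) Z (?e t s) (Y t s)" for t s
    using Y by (simp add: spectral_representation_def)
  have meas: "?e t s \<in> borel_measurable spectral_domain" for t and s :: "real ^ 'd"
    using I[of s t] unfolding has_stoch_integral_def spectral_measure_def by simp
  have "cov_fun M Y h u = (\<integral>x. cnj (Y 0 0 x) * Y u h x \<partial>M)"
    by (simp add: cov_fun_def covariance_def mean)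
  also have "\<dots> = (\<integral>p. cnj (?e 0 0 p) * ?e u h p \<partial>spectral_measure f)"
    by (rule stoch_integral_isometry(3)[OF Z I I])
  also have "\<dots> = (\<integral>p. ?e u h p \<partial>spectral_measure f)"
    by (rule Bochner_Integration.integral_cong) (auto simp: split_beta')
  also have "\<dots> = (\<integral>p. f p *\<^sub>R ?e u h p \<partial>spectral_domain)"
    unfolding spectral_measure_def using f f_nonneg by (intro integral_density meas) auto
  also have "\<dots> = (\<integral>(l, w). of_real (f (l, w)) * exp (\<i> * of_real (h \<bullet> l + of_int u * w)) \<partial>spectral_domain)"
    by (rule Bochner_Integration.integral_cong) (auto simp: scaleR_conv_of_real)
  finally show ?thesis .
qed

text \<open>Characters have modulus 1 and \<open>f\<close> is integrable on the product, so Fubini's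
  theorem applies to \<open>cov_fun_spectral\<close>: integrating out the wave number first exhibits
  the covariances as Fourier coefficients in the frequency.\<close>

lemma is_cross_spectrum_wave_number_integral:
  fixes f :: "(real ^ 'd) \<times> real \<Rightarrow> real"
  assumes f: "integrable spectral_domain f" and f_nonneg: "AE p in spectral_domain. f p \<ge> 0"
    and mean: "\<And>t s. (\<integral>x. Y t s x \<partial>M) = 0"
    and Z: "orthogonal_increments M (spectral_measure f) Z"
    and Y: "spectral_representation M (spectral_measure f) Z Y"
  shows "is_cross_spectrum M Y h (\<lambda>w. \<integral>l. exp (\<i> * of_real (h \<bullet> l)) * complex_of_real (f (l, w)) \<partial>lborel)"
  unfolding is_cross_spectrum_def
proof (intro conjI allI)
  interpret pair_sigma_finite "lborel :: (real ^ 'd) measure" freq_domain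
    by (rule pair_sigma_finite_spectral_domain)
  have [measurable]: "f \<in> borel_measurable (lborel \<Otimes>\<^sub>M freq_domain)"
    using f by (simp add: spectral_domain_def)
  have [measurable]: "snd \<in> borel_measurable ((lborel :: (real ^ 'd) measure) \<Otimes>\<^sub>M freq_domain)"
    by (rule measurable_compose[OF measurable_snd borel_measurable_freq_domain]) simp
  have e: "exp (\<i> * of_real (h \<bullet> l + of_int u * w)) = exp (\<i> * of_real (h \<bullet> l)) * cis (of_int u * w)" for l w and u :: int
    by (simp add: distrib_left exp_add cis_conv_exp)
  have int: "integrable (lborel \<Otimes>\<^sub>M freq_domain)
      (\<lambda>(l, w). cis (of_int u * w) * (exp (\<i> * of_real (h \<bullet> l)) * complex_of_real (f (l, w))))" for u :: int
  proof (rule Bochner_Integration.integrable_bound)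
    show "integrable (lborel \<Otimes>\<^sub>M freq_domain) f" using f by (simp add: spectral_domain_def)
  qed (auto simp: norm_mult split_beta')
  show "integrable freq_domain (\<lambda>w. \<integral>l. exp (\<i> * of_real (h \<bullet> l)) * complex_of_real (f (l, w)) \<partial>lborel)"
    using integrable_snd[OF int[of 0]] by simp
  fix u :: int
  have "cov_fun M Y h u = (\<integral>(l, w). cis (of_int u * w) * (exp (\<i> * of_real (h \<bullet> l)) * complex_of_real (f (l, w))) \<partial>(lborel \<Otimes>\<^sub>M freq_domain))"
    unfolding cov_fun_spectral[OF assms] spectral_domain_def e
    by (rule Bochner_Integration.integral_cong) (auto simp: mult_ac)
  also have "\<dots> = (\<integral>w. \<integral>l. cis (of_int u * w) * (exp (\<i> * of_real (h \<bullet> l)) * complex_of_real (f (l, w))) \<partial>lborel \<partial>freq_domain)"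
    by (rule integral_snd[OF int, symmetric])
  also have "\<dots> = (\<integral>w. exp (\<i> * complex_of_real (real_of_int u * w)) *
        (\<integral>l. exp (\<i> * of_real (h \<bullet> l)) * complex_of_real (f (l, w)) \<partial>lborel) \<partial>freq_domain)"
    by (simp add: cis_conv_exp)
  finally show "(\<integral>w. exp (\<i> * complex_of_real (real_of_int u * w)) *
        (\<integral>l. exp (\<i> * of_real (h \<bullet> l)) * complex_of_real (f (l, w)) \<partial>lborel) \<partial>freq_domain) = cov_fun M Y h u" ..
qed

text \<open>With \<open>P = pi powr (D / 2)\<close> and \<open>T = 2 powr (D / 2)\<close>, the
  denominator \<open>(2 * pi) ^ D\<close> is the square of \<open>P * T\<close>. One
  \<open>P\<close> cancels against the power of pi from the Gaussian transform, and one
  \<open>T\<close> against \<open>2 powr (- \<mu>) = T / 2 powr a\<close>.\<close>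

lemma matern_constant:
  fixes \<mu> a q x G K \<sigma> :: real
  assumes "q > 0" "x > 0" "\<mu> = a - real D / 2"
  shows "\<sigma>\<^sup>2 / (2 * pi) ^ D * (2 * pi powr (D / 2) / G * (x / (2 * q)) powr \<mu> * K) =
    \<sigma>\<^sup>2 / ((2 * pi) powr (real D / 2) * 2 powr (a - 1) * G) * (x / q) powr \<mu> * K"
proof -
  define P where "P = pi powr (D / 2)"
  define T where "T = 2 powr (real D / 2)"
  have pos: "P > 0" "T > 0" by (auto simp: P_def T_def)
  have PT: "(2 * pi) powr (real D / 2) = P * T" by (simp add: P_def T_def powr_mult)
  have "(2 * pi) ^ D = (2 * pi) powr (real D / 2 + real D / 2)"
    by (simp add: powr_realpow)
  then have pow: "(2 * pi) ^ D = (P * T) * (P * T)"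
    by (simp only: powr_add PT)
  have "(x / (2 * q)) powr \<mu> = (x / q / 2) powr \<mu>" by (simp add: mult.commute)
  also have "\<dots> = (x / q) powr \<mu> / 2 powr \<mu>"
    using assms by (subst powr_divide) auto
  also have "2 powr \<mu> = 2 powr a / T"
    by (simp add: assms T_def powr_diff)
  finally have x: "(x / (2 * q)) powr \<mu> = (x / q) powr \<mu> * T / 2 powr a" by simp
  have a: "2 powr (a - 1) = 2 powr a / 2" by (simp add: powr_diff)
  show ?thesis
    unfolding PT pow x a P_def[symmetric] using pos by (simp add: field_simps)
qed

theorem theorem2:
  fixes M :: "'w measure"
    and Y :: "int \<Rightarrow> real ^ 'd \<Rightarrow> 'w \<Rightarrow> complex"
    and f\<^sub>Y :: "(real ^ 'd) \<times> real \<Rightarrow> real"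
    and Z\<^sub>Y Z\<^sub>e :: "((real ^ 'd) \<times> real) set \<Rightarrow> 'w \<Rightarrow> complex"
    and c :: "real \<Rightarrow> complex"
    and \<nu> \<sigma>\<^sub>e :: real
    and n :: nat
    and k :: int
  assumes "prob_space M"
    and "CARD('d) \<ge> 2"
    and "\<nu> > 0"
    and "n \<ge> 1"
    and "second_order_stationary M Y"
    and "\<And>t s. (\<integral>x. Y t s x \<partial>M) = 0"
    and "integrable spectral_domain f\<^sub>Y"
    and "AE p in spectral_domain. f\<^sub>Y p \<ge> 0"
    and "orthogonal_increments M (spectral_measure f\<^sub>Y) Z\<^sub>Y"
    and "spectral_representation M (spectral_measure f\<^sub>Y) Z\<^sub>Y Y"
    and "orthogonal_increments M (white_noise_spectrum \<sigma>\<^sub>e) Z\<^sub>e"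
    and "c \<in> borel_measurable freq_domain"
    and "\<And>w. w \<in> {-pi..pi} \<Longrightarrow> cmod (c w) > 0"
    and "satisfies_fractional_spde M (spectral_measure f\<^sub>Y) Z\<^sub>Y
           (white_noise_spectrum \<sigma>\<^sub>e) Z\<^sub>e n k c \<nu>"
  shows "(AE (l, w) in spectral_domain.
            f\<^sub>Y (l, w) = \<sigma>\<^sub>e\<^sup>2 / (2 * pi) ^ CARD('d) *
              (1 / ((\<Sum>i\<in>UNIV. (l $ i)\<^sup>2) + (cmod (c w))\<^sup>2) powr (2 * \<nu>))) \<and>
         (isotropic M Y \<longrightarrow>
            (\<forall>h. h \<noteq> 0 \<longrightarrow>
               (\<exists>g. is_cross_spectrum M Y h g) \<and>
               (\<forall>g. is_cross_spectrum M Y h g \<longrightarrow>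
                  (AE w in freq_domain.
                     g w = complex_of_real
                       (\<sigma>\<^sub>e\<^sup>2 / ((2 * pi) powr (real CARD('d) / 2) * 2 powr (2 * \<nu> - 1) * Gamma (2 * \<nu>)) *
                        (norm h / cmod (c w)) powr (2 * \<nu> - real CARD('d) / 2) *
                        bessel_K (2 * \<nu> - real CARD('d) / 2) (norm h * cmod (c w)))))))"
proof -
  note n = assms(4) and mean = assms(6) and f = assms(7) and f_nonneg = assms(8) and ZY = assms(9)
    and Y = assms(10) and Ze = assms(11) and c_meas = assms(12) and c = assms(13) and spde = assms(14)
  interpret pair_sigma_finite "lborel :: (real ^ 'd) measure" freq_domain
    by (rule pair_sigma_finite_spectral_domain)
  let ?C = "\<sigma>\<^sub>e\<^sup>2 / (2 * pi) ^ CARD('d)"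
  define r where "r w l = (norm l)\<^sup>2 + (cmod (c w))\<^sup>2" for w and l :: "real ^ 'd"
  have fY: "AE (l, w) in spectral_domain. f\<^sub>Y (l, w) = ?C * r w l powr (- (2 * \<nu>))"
    unfolding r_def by (rule spectral_density_from_spde[OF n f f_nonneg ZY Ze c_meas c spde])
  \<comment> \<open>The cross spectrum needs the density for almost every wave number at a fixed
    frequency. \<open>AE_pair\<close> yields the quantifiers in the other order, and
    \<open>AE_commute\<close> exchanges them for a measurable set.\<close>
  have AE_fY: "AE w in freq_domain. (AE l in lborel. f\<^sub>Y (l, w) = ?C * r w l powr (- (2 * \<nu>)))"
  proof -
    have [measurable]: "c \<in> borel_measurable freq_domain" "f\<^sub>Y \<in> borel_measurable (lborel \<Otimes>\<^sub>M freq_domain)"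
      using c_meas f by (auto simp: spectral_domain_def)
    have AE: "AE l in lborel. AE w in freq_domain. f\<^sub>Y (l, w) = ?C * r w l powr (- (2 * \<nu>))"
      using AE_pair[OF fY[unfolded spectral_domain_def]] unfolding prod.case .
    have [measurable]: "(\<lambda>p. r (snd p) (fst p)) \<in> borel_measurable (lborel \<Otimes>\<^sub>M freq_domain)"
      unfolding r_def by measurable
    have "{p \<in> space (lborel \<Otimes>\<^sub>M freq_domain).
        f\<^sub>Y (fst p, snd p) = ?C * r (snd p) (fst p) powr (- (2 * \<nu>))} \<in> sets (lborel \<Otimes>\<^sub>M freq_domain)"
      unfolding prod.collapse by measurable
    from AE_commute[OF this] AE show ?thesis by (rule iffD1)
  qed
  have AE_int: "AE w in freq_domain. integrable lborel (\<lambda>l. f\<^sub>Y (l, w))"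
    using f by (intro AE_integrable_snd) (simp add: spectral_domain_def)
  show ?thesis
  proof (intro conjI impI allI)
    show "AE (l, w) in spectral_domain. f\<^sub>Y (l, w) = ?C *
              (1 / ((\<Sum>i\<in>UNIV. (l $ i)\<^sup>2) + (cmod (c w))\<^sup>2) powr (2 * \<nu>))"
      using fY by (simp add: r_def norm_power2_eq_sum powr_minus_divide)
    fix h :: "real ^ 'd" assume h: "h \<noteq> 0"
    \<comment> \<open>\<open>G\<close> is one cross spectrum, which settles existence; uniqueness of
      Fourier coefficients will show that every other one agrees with it almost everywhere.\<close>
    define G where "G w = (\<integral>l. exp (\<i> * of_real (h \<bullet> l)) * complex_of_real (f\<^sub>Y (l, w)) \<partial>lborel)" for w
    have G: "is_cross_spectrum M Y h G"
      unfolding G_def by (rule is_cross_spectrum_wave_number_integral[OF f f_nonneg mean ZY Y])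
    then show "\<exists>g. is_cross_spectrum M Y h g" by blast
    let ?\<mu> = "2 * \<nu> - real CARD('d) / 2"
    let ?B = "\<lambda>w. \<sigma>\<^sub>e\<^sup>2 / ((2 * pi) powr (real CARD('d) / 2) * 2 powr (2 * \<nu> - 1) * Gamma (2 * \<nu>)) *
                        (norm h / cmod (c w)) powr ?\<mu> * bessel_K ?\<mu> (norm h * cmod (c w))"
    have GB: "AE w in freq_domain. G w = complex_of_real (?B w)"
      using AE_fY AE_int AE_space
    proof eventually_elim
      case (elim w)
      have q: "cmod (c w) > 0" using c[of w] elim(3) by simp
      have [measurable]: "(\<lambda>l. f\<^sub>Y (l, w)) \<in> borel_measurable borel" using elim(2) by simp
      have [measurable]: "r w \<in> borel_measurable borel" unfolding r_def by measurable
      have "G w = (\<integral>l. of_real ?C * (exp (\<i> * of_real (h \<bullet> l)) * complex_of_real (r w l powr (- (2 * \<nu>)))) \<partial>lborel)"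
        unfolding G_def by (rule integral_cong_AE) (use elim(1) in auto)
      also have "\<dots> = of_real ?C * (\<integral>l. exp (\<i> * of_real (h \<bullet> l)) * complex_of_real (r w l powr (- (2 * \<nu>))) \<partial>lborel)"
        by simp
      finally have Gw: "G w = of_real ?C * (\<integral>l. exp (\<i> * of_real (h \<bullet> l)) * complex_of_real (r w l powr (- (2 * \<nu>))) \<partial>lborel)" .
      show ?case
      proof (cases "\<sigma>\<^sub>e = 0")
        \<comment> \<open>For \<open>\<sigma>\<^sub>e = 0\<close> both sides vanish. This case is
          separate because a vanishing density says nothing about integrability of the power of
          \<open>r\<close>.\<close>
        case True
        then show ?thesis unfolding Gw by simp
      next
        case False
        \<comment> \<open>The integrability needed by \<open>fourier_matern\<close>, that is, 4
          \<nu> greater than the dimension, is not assumed: it is inherited from the finite variance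
          through \<open>f\<^sub>Y\<close>, after division by the nonzero constant
          \<open>?C\<close>.\<close>
        have "integrable lborel (\<lambda>l. ?C * r w l powr (- (2 * \<nu>)))"
          using elim(2) by (rule integrable_cong_AE_imp) (use elim(1) in auto)
        then have int: "integrable lborel (\<lambda>l :: real ^ 'd. ((norm l)\<^sup>2 + (cmod (c w))\<^sup>2) powr (- (2 * \<nu>)))"
          unfolding r_def by (rule integrable_mult_left_iff[THEN iffD1, THEN disjE]) (use False in auto)
        have a: "2 * \<nu> > 0" using assms(3) by simp
        have "G w = of_real (?C * (2 * pi powr (CARD('d) / 2) / Gamma (2 * \<nu>) *
            (norm h / (2 * cmod (c w))) powr ?\<mu> * bessel_K ?\<mu> (norm h * cmod (c w))))"
          unfolding Gw r_def fourier_matern[OF a q h int] by simp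
        also have "\<dots> = of_real (?B w)"
          using q h by (subst matern_constant) auto
        finally show ?thesis .
      qed
    qed
    fix g assume g: "is_cross_spectrum M Y h g"
    have "AE w in freq_domain. g w = G w"
      by (rule fourier_coefficients_unique) (use g G in \<open>auto simp: is_cross_spectrum_def\<close>)
    then show "AE w in freq_domain. g w = complex_of_real (?B w)"
      using GB by eventually_elim simp
  qed
qed

end
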